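(* Let $\{(A_n,p_n)\}_{n\in\mathbb{N}}$ be a rare-events source with limit distribution $P$, and let $\check c$ and $\hat c$ be respectively the essential infimum and the essential supremum of a random variable $Z\sim P$. Let $\tilde P_n$, $n\in\mathbb{N}$, be random probability measures on $\mathbb{R}^+$, where $\tilde P_n$ is constructed from the samples $X_{n,1},\dots,X_{n,n}$, such that almost surely $\tilde P_n\Rightarrow P$ weakly and such that, for some $s>0$, $n^s d_{\mathrm W}(\tilde P_n,P)\to0$ almost surely. (This holds in particular if $n^r d_{\mathrm W}(P_n,P)\to0$ for some $r>0$, $P$ is known to be supported on at most $m$ points, and $\tilde P_n$ is a minimum distance estimator with parameter $m$ and precision $\epsilon_n<n^{-\min\{r,1/2\}}$.) Given $q\ne0$ and $D\ge1$, let $x_D^q$ denote the $D$-tapered version of the function $x\mapsto x^q$. If $q_n=\log n/\log\log n$ and $D_n=n^{s/(2q_n)}$, then, as $n\to\infty$, $$\left(\int_{\mathbb{R}^+}x_{D_n}^{-q_n}\,\mathrm{d}\tilde P_n(x)\right)^{1/q_n}\to\check c\quad\text{almost surely}$$ and $$\left(\int_{\mathbb{R}^+}x_{D_n}^{q_n}\,\mathrm{d}\tilde P_n(x)\right)^{1/q_n}\to\hat c\quad\text{almost surely.}$$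
   Context: Rare-events source: a sequence $\{(A_n,p_n)\}_{n\in\mathbb{N}}$, where $A_n$ is a finite alphabet and $p_n$ a probability mass function on $A_n$, such that, with $X_n\sim p_n$, $Z_n=n\,p_n(X_n)$ and $P_n$ the distribution of $Z_n$: (i) there is an interval $C=[\check c,\hat c]$ with $0<\check c\le\hat c<\infty$ such that $\check c/n\le p_n(a)\le\hat c/n$ for all $n$ and all $a\in A_n$; (ii) there is a probability distribution $P$ with $P_n\Rightarrow P$ weakly (so $P$ is supported on $C$). It is assumed that $\check c$ and $\hat c$ are the essential infimum and essential supremum of $Z\sim P$. Sampling: for each $n$, $X_{n,1},\dots,X_{n,n}$ are independent samples from $p_n$. Tapered function: for a real-valued function $g$ on $\mathbb{R}^+$ and $D\ge1$, the $D$-tapered version $g_D$ is given by $g_D(x)=g(D^{-1})$ for $x<D^{-1}$, $g_D(x)=g(x)$ for $x\in[D^{-1},D]$, and $g_D(x)=g(D)$ for $x>D$. Wasserstein distance between probability measures on $\mathbb{R}^+$: $d_{\mathrm W}(Q_1,Q_2)=\int_{\mathbb{R}^+}|F(x;Q_1)-F(x;Q_2)|\,\mathrm{d}x$, where $F(\cdot;Q)$ is the cumulative distribution function of $Q$. Minimum distance estimator: let $\phi_n=\{\phi_{n,k}\}_{k\ge0}$ be the Good-Turing estimator, $\phi_{n,k}=(k+1)\varphi_{n,k+1}/n$, where $\varphi_{n,k}$ is the number of symbols of $A_n$ appearing exactly $k$ times in $X_{n,1},\dots,X_{n,n}$. For a probability measure $Q$ on $\mathbb{R}^+$ let $\pi(Q)$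 be the Poisson $Q$-mixture, $\pi(Q)_k=\int x^ke^{-x}/k!\,\mathrm{d}Q(x)$. A minimum distance estimator with parameter $m$ and precision $\epsilon$ is any probability measure $\tilde P$ on $\mathbb{R}^+$ with $\sup_k|F(k;\pi(\tilde P))-F(k;\phi_n)|\le\inf_Q\sup_k|F(k;\pi(Q))-F(k;\phi_n)|+\epsilon$, the infimum being over probability measures on $\mathbb{R}^+$ supported on at most $m$ points.
   Formalization: In the first limit the root exponent is corrected from 1/q_n to -1/q_n (as printed the limit is 1/č); in the parenthetical, the rate n^s d_W→0 is proved only when a.s. all P̃_n live on a common bounded interval (as printed it fails: small mass may sit arbitrarily far out). *)

theory Defs
  imports "HOL-Probability.Probability"
begin

text \<open>All sequences are indexed by \<open>n \<ge> 1\<close>; values at \<open>n = 0\<close> are never constrained.\<close>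

subsection \<open>Probability measures on the nonnegative half-line\<close>

definition nonneg_distribution :: "real measure \<Rightarrow> bool" where
  "nonneg_distribution Q \<longleftrightarrow> real_distribution Q \<and> measure Q {0..} = 1"

definition supported_on_at_most :: "nat \<Rightarrow> real measure \<Rightarrow> bool" where
  "supported_on_at_most m Q \<longleftrightarrow> (\<exists>S. finite S \<and> card S \<le> m \<and> measure Q S = 1)"

text \<open>The essential infimum, dual to the library's \<open>esssup\<close> (see \<open>esssup_eq_AE\<close>).\<close>

definition essinf :: "'a measure \<Rightarrow> ('a \<Rightarrow> ereal) \<Rightarrow> ereal" where
  "essinf M f = Sup {z. AE x in M. z \<le> f x}"

text \<open>The value is extended, because the distance of two laws without first moments may be
  infinite; a Bochner integral would silently return \<open>0\<close> in that case.\<close>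

definition wasserstein :: "real measure \<Rightarrow> real measure \<Rightarrow> ennreal" where
  "wasserstein Q1 Q2 = (\<integral>\<^sup>+ x\<in>{0..}. ennreal \<bar>cdf Q1 x - cdf Q2 x\<bar> \<partial>lborel)"

definition tapered :: "real \<Rightarrow> (real \<Rightarrow> real) \<Rightarrow> real \<Rightarrow> real" where
  "tapered D g x = (if x < 1 / D then g (1 / D) else if x \<le> D then g x else g D)"

subsection \<open>Rare-events sources and their samples\<close>

definition rare_law :: "(nat \<Rightarrow> 'a pmf) \<Rightarrow> nat \<Rightarrow> real measure" where
  "rare_law p n = distr (measure_pmf (p n)) borel (\<lambda>a. real n * pmf (p n) a)"

definition rare_events_source ::
    "(nat \<Rightarrow> 'a set) \<Rightarrow> (nat \<Rightarrow> 'a pmf) \<Rightarrow> real measure \<Rightarrow> real \<Rightarrow> real \<Rightarrow> bool" where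
  "rare_events_source A p P c_lo c_hi \<longleftrightarrow>
     (\<forall>n\<ge>1. finite (A n) \<and> set_pmf (p n) \<subseteq> A n) \<and>
     0 < c_lo \<and> c_lo \<le> c_hi \<and>
     (\<forall>n\<ge>1. \<forall>a\<in>A n. c_lo / real n \<le> pmf (p n) a \<and> pmf (p n) a \<le> c_hi / real n) \<and>
     real_distribution P \<and> weak_conv_m (rare_law p) P"

text \<open>Independence is only required within each row \<open>X n 1, \<dots>, X n n\<close>; the joint
  law of different rows is arbitrary.\<close>

definition iid_samples ::
    "'s measure \<Rightarrow> (nat \<Rightarrow> 'a pmf) \<Rightarrow> (nat \<Rightarrow> nat \<Rightarrow> 's \<Rightarrow> 'a) \<Rightarrow> bool" where
  "iid_samples M p X \<longleftrightarrow>
     prob_space M \<and>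
     (\<forall>n\<ge>1. prob_space.indep_vars M (\<lambda>_. count_space UNIV) (X n) {1..n} \<and>
        (\<forall>i\<in>{1..n}. distr M (count_space UNIV) (X n i) = measure_pmf (p n)))"

definition sample_list :: "(nat \<Rightarrow> nat \<Rightarrow> 's \<Rightarrow> 'a) \<Rightarrow> nat \<Rightarrow> 's \<Rightarrow> 'a list" where
  "sample_list X n \<omega> = map (\<lambda>i. X n i \<omega>) [1..<Suc n]"

subsection \<open>Minimum distance estimation\<close>

definition num_seen :: "'a set \<Rightarrow> 'a list \<Rightarrow> nat \<Rightarrow> nat" where
  "num_seen A xs k = card {a \<in> A. count_list xs a = k}"

definition good_turing :: "'a set \<Rightarrow> 'a list \<Rightarrow> nat \<Rightarrow> real" where
  "good_turing A xs k = real ((k + 1) * num_seen A xs (k + 1)) / real (length xs)"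

definition poisson_mixture :: "real measure \<Rightarrow> nat \<Rightarrow> real" where
  "poisson_mixture Q k = (LINT x:{0..}|Q. x ^ k * exp (- x) / fact k)"

text \<open>Both partial sums lie in \<open>[0, 1]\<close> for the mass functions considered here, so the real
  supremum and infimum below are taken over bounded sets.\<close>

definition mixture_gap :: "(nat \<Rightarrow> real) \<Rightarrow> real measure \<Rightarrow> real" where
  "mixture_gap \<phi> Q = (SUP k. \<bar>(\<Sum>i\<le>k. poisson_mixture Q i) - (\<Sum>i\<le>k. \<phi> i)\<bar>)"

text \<open>Only the competitors are restricted to at most \<open>m\<close> atoms, not the estimate itself.\<close>

definition min_distance_estimate ::
    "nat \<Rightarrow> real \<Rightarrow> (nat \<Rightarrow> real) \<Rightarrow> real measure \<Rightarrow> bool" where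
  "min_distance_estimate m \<epsilon> \<phi> Q \<longleftrightarrow>
     nonneg_distribution Q \<and>
     mixture_gap \<phi> Q \<le>
       (INF Q'\<in>{Q'. nonneg_distribution Q' \<and> supported_on_at_most m Q'}. mixture_gap \<phi> Q') + \<epsilon>"

end

theory Submission
  imports Defs "HOL-Real_Asymp.Real_Asymp" "HOL-Computational_Algebra.Polynomial"
begin

text \<open>
  With \<open>D n = (ln n) powr (s / 2)\<close> and \<open>D n powr q n = n powr (s / 2)\<close>, the tapered functions
  \<open>x \<mapsto> x powr (\<plusminus> q n)\<close> have Lipschitz constants \<open>n powr (s / 2)\<close> up to polylogarithmic factors, so
  replacing the estimate by \<open>P\<close> costs \<open>n powr (- s / 2)\<close> up to such factors. This is negligible even
  after division by \<open>y powr q n\<close>, which is \<open>n powr o(1)\<close>; and under \<open>P\<close> itself the root of the moment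
  is an \<open>L\<^sup>p\<close> norm with \<open>p \<longlonglongrightarrow> \<infinity>\<close>.

  For the minimum distance estimator, the Good-Turing estimate concentrates around its mean
  (McDiarmid), the mean is close to the Poisson mixture of the law of the source (binomial versus
  Poisson), and the latter is close to that of \<open>P\<close> (Poisson distribution functions are
  \<open>1\<close>-Lipschitz in the parameter). Hence the Poisson mixtures of the estimate and of \<open>P\<close> are
  polynomially close. To invert the mixing, note that a polynomial times \<open>exp (- x)\<close> integrates to a
  finite combination of mixture probabilities. Testing with a polynomial that vanishes to high
  even order at the atoms of \<open>P\<close> shows that the estimate puts little mass far from them, and testing
  with interpolation polynomials compares the masses near the atoms.
\<close>

subsection \<open>Wasserstein distance and Lipschitz functions\<close>

text \<open>Poisson mixing is badly conditioned to invert in general. Here \<open>P\<close> has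
  finitely many atoms but the estimate is arbitrary, so identities special to laws with m atoms
  cannot be applied to it. What remains is a one-sided bound of the mass that \<open>P\<close> gives
  to a set of atoms by the mass that the estimate gives to a neighbourhood of it. Used for the atoms
  left of a point and for those right of it, it bounds the difference of the distribution functions
  on both sides. Its constants depend on \<open>P\<close> alone, so the width of the neighbourhoods
  can be tuned afterwards. The bounds so obtained limit how much mass lies away from the atoms, not
  how far out it lies. Hence weak convergence comes without further conditions, while the
  Wasserstein rate is proved under a common bound on the supports of the estimates. Chance enters
  only through events on sample lists and Borel-Cantelli; the rest is argued path by path, which is
  why the estimate may be an arbitrary function of the sample list.\<close>

lemma clamp_expectation:
  fixes g g' :: "real \<Rightarrow> real"
  assumes "a \<le> b" and deriv: "\<And>x. a \<le> x \<Longrightarrow> x \<le> b \<Longrightarrow> DERIV g x :> g' x"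
    and cont: "\<And>x. a \<le> x \<Longrightarrow> x \<le> b \<Longrightarrow> isCont g' x"
    and "real_distribution Q"
  shows "integrable lborel (\<lambda>t. g' t * indicator {a..b} t * (1 - cdf Q t))"
    and "integrable Q (\<lambda>x. g (max a (min b x)))"
    and "(LINT x|Q. g (max a (min b x)))
       = g a + (LINT t|lborel. g' t * indicator {a..b} t * (1 - cdf Q t))"
proof -
  interpret Q: real_distribution Q by fact
  interpret pair_sigma_finite Q lborel by standard
  define G where "G t = g' t * indicator {a..b} t" for t
  have G: "integrable lborel G"
    using has_bochner_integral_FTC_Icc_real[OF \<open>a \<le> b\<close> deriv cont]
    unfolding G_def has_bochner_integral_iff by blast
  then have [measurable]: "G \<in> borel_measurable borel"
    using borel_measurable_integrable by force
  \<comment> \<open>Layer-cake form: integrating \<open>f x t\<close> over t gives \<open>g\<close>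
    at the clamped x minus \<open>g a\<close>, integrating it over x gives \<open>G t\<close> times
    the tail \<open>1 - cdf Q t\<close>, and Fubini equates the two orders.\<close>
  define f where "f x t = G t * indicator {..<x} t" for x t
  have [measurable]: "f x \<in> borel_measurable borel" for x
    unfolding f_def by measurable
  have f_meas: "case_prod f \<in> borel_measurable (Q \<Otimes>\<^sub>M lborel)"
  proof -
    have "case_prod f = (\<lambda>z. G (snd z) * (if snd z < fst z then 1 else 0))"
      by (auto simp: f_def fun_eq_iff)
    then show ?thesis by simp
  qed
  have inner: "(LINT t|lborel. f x t) = g (max a (min b x)) - g a" for x
  proof -
    let ?c = "max a (min b x)"
    have c: "a \<le> ?c" "?c \<le> b" using \<open>a \<le> b\<close> by auto
    have "(LINT t|lborel. f x t) = (LINT t|lborel. g' t * indicator {a..?c} t)"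
    proof (rule integral_cong_AE)
      have "integrable lborel (\<lambda>t. g' t * indicator {a..?c} t)"
        using has_bochner_integral_FTC_Icc_real[OF c(1) deriv cont] c(2)
        unfolding has_bochner_integral_iff by force
      then show "(\<lambda>t. g' t * indicator {a..?c} t) \<in> borel_measurable lborel" by auto
      \<comment> \<open>The integrands can differ at t = x, because of \<open>{..<x}\<close>, and at
        t = a, because \<open>{a..?c}\<close> is the single point a when x \<le> a.\<close>
      have "AE t in lborel. t \<noteq> x" "AE t in lborel. t \<noteq> a" by (rule AE_lborel_singleton)+
      then show "AE t in lborel. f x t = g' t * indicator {a..?c} t"
        by eventually_elim (auto simp: f_def G_def indicator_def)
    qed (simp add: f_def)
    also have "\<dots> = g ?c - g a"
      using integral_FTC_Icc_real[OF c(1) deriv cont] c(2) by force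
    finally show ?thesis .
  qed
  have int: "integrable (Q \<Otimes>\<^sub>M lborel) (case_prod f)"
  proof (rule Fubini_integrable[OF f_meas])
    have fi: "integrable lborel (f x)" for x
      by (rule Bochner_Integration.integrable_bound[OF G]) (auto simp: f_def indicator_def)
    then show "AE x in Q. integrable lborel (\<lambda>t. case_prod f (x, t))" by simp
    have "norm (LINT t|lborel. norm (f x t)) \<le> (LINT t|lborel. norm (G t))" for x
    proof -
      have "(LINT t|lborel. norm (f x t)) \<le> (LINT t|lborel. norm (G t))"
        by (rule integral_mono[OF integrable_norm[OF fi] integrable_norm[OF G]])
           (simp add: f_def indicator_def)
      then show ?thesis by simp
    qed
    moreover have "(\<lambda>x. LINT t|lborel. norm (f x t)) \<in> borel_measurable Q"
      using f_meas by measurable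
    ultimately show "integrable Q (\<lambda>x. LINT t|lborel. norm (case_prod f (x, t)))"
      by (intro Q.integrable_const_bound) auto
  qed
  have outer: "(LINT x|Q. f x t) = G t * (1 - cdf Q t)" for t
  proof -
    have "(LINT x|Q. f x t) = (LINT x|Q. G t * indicator {t<..} x)"
      by (intro Bochner_Integration.integral_cong) (auto simp: f_def indicator_def)
    also have "\<dots> = G t * measure Q {t<..}" by simp
    also have "measure Q {t<..} = 1 - cdf Q t"
      using Q.prob_compl[of "{..t}"] by (simp add: cdf_def Compl_eq_Diff_UNIV[symmetric])
    finally show ?thesis .
  qed
  show "integrable lborel (\<lambda>t. g' t * indicator {a..b} t * (1 - cdf Q t))"
    using integrable_snd[OF int] by (simp add: outer G_def)
  have *: "integrable Q (\<lambda>x. g (max a (min b x)) - g a)"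
    using integrable_fst[OF int] by (simp add: inner)
  have "integrable Q (\<lambda>x. (g (max a (min b x)) - g a) + g a)"
    by (rule Bochner_Integration.integrable_add[OF *]) simp
  then show **: "integrable Q (\<lambda>x. g (max a (min b x)))" by simp
  have "(LINT x|Q. g (max a (min b x)) - g a)
       = (LINT t|lborel. g' t * indicator {a..b} t * (1 - cdf Q t))"
    using Fubini_integral[OF int] by (simp add: inner outer G_def)
  then show "(LINT x|Q. g (max a (min b x)))
       = g a + (LINT t|lborel. g' t * indicator {a..b} t * (1 - cdf Q t))"
    using ** Q.prob_space by simp
qed

text \<open>The easy half of Kantorovich duality: subtracting two layer-cake formulas leaves the
  integral of \<open>g'\<close> against the difference of the distribution functions. Clamping keeps
  the expectations finite without moment conditions, and \<open>0 \<le> a\<close> places the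
  interval where \<open>wasserstein\<close> integrates.\<close>

lemma clamp_expectation_diff_le_wasserstein:
  fixes g g' :: "real \<Rightarrow> real"
  assumes "0 \<le> a" "a \<le> b" and deriv: "\<And>x. a \<le> x \<Longrightarrow> x \<le> b \<Longrightarrow> DERIV g x :> g' x"
    and cont: "\<And>x. a \<le> x \<Longrightarrow> x \<le> b \<Longrightarrow> isCont g' x"
    and L: "\<And>x. a \<le> x \<Longrightarrow> x \<le> b \<Longrightarrow> \<bar>g' x\<bar> \<le> L"
    and Q: "real_distribution Q1" "real_distribution Q2"
  shows "ennreal \<bar>(LINT x|Q1. g (max a (min b x))) - (LINT x|Q2. g (max a (min b x)))\<bar>
     \<le> ennreal L * wasserstein Q1 Q2"
proof -
  interpret Q1: real_distribution Q1 by fact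
  interpret Q2: real_distribution Q2 by fact
  have [measurable]: "cdf Q1 \<in> borel_measurable borel" "cdf Q2 \<in> borel_measurable borel"
    using Q1.cdf_nondecreasing Q2.cdf_nondecreasing
    by (auto intro!: borel_measurable_mono simp: mono_def)
  note c1 = clamp_expectation[OF assms(2) deriv cont Q(1)]
  note c2 = clamp_expectation[OF assms(2) deriv cont Q(2)]
  have "L \<ge> 0" using L[of a] \<open>a \<le> b\<close> by auto
  let ?f = "\<lambda>t. g' t * indicator {a..b} t * (1 - cdf Q1 t) - g' t * indicator {a..b} t * (1 - cdf Q2 t)"
  have int: "integrable lborel ?f" using c1(1) c2(1) by (rule Bochner_Integration.integrable_diff)
  have "(LINT x|Q1. g (max a (min b x))) - (LINT x|Q2. g (max a (min b x))) = (LINT t|lborel. ?f t)"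
    using c1 c2 by simp
  then have "ennreal \<bar>(LINT x|Q1. g (max a (min b x))) - (LINT x|Q2. g (max a (min b x)))\<bar>
      \<le> (\<integral>\<^sup>+t. ennreal (norm (?f t)) \<partial>lborel)"
    using integral_norm_bound_ennreal[OF int] by simp
  also have "\<dots> \<le> (\<integral>\<^sup>+t. ennreal L * (ennreal \<bar>cdf Q1 t - cdf Q2 t\<bar> * indicator {0..} t) \<partial>lborel)"
  proof (intro nn_integral_mono)
    fix t
    have "norm (?f t) \<le> L * (\<bar>cdf Q1 t - cdf Q2 t\<bar> * indicator {0..} t)"
    proof (cases "t \<in> {a..b}")
      case True
      have "?f t = - (g' t * (cdf Q1 t - cdf Q2 t))" using True by (simp add: algebra_simps)
      then have "norm (?f t) = \<bar>g' t\<bar> * \<bar>cdf Q1 t - cdf Q2 t\<bar>" by (simp add: abs_mult)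
      also have "\<dots> \<le> L * \<bar>cdf Q1 t - cdf Q2 t\<bar>"
        using L[of t] True by (intro mult_right_mono) auto
      finally show ?thesis using True \<open>0 \<le> a\<close> by simp
    qed (use \<open>L \<ge> 0\<close> in simp)
    then have "ennreal (norm (?f t)) \<le> ennreal (L * (\<bar>cdf Q1 t - cdf Q2 t\<bar> * indicator {0..} t))"
      by (rule ennreal_leI)
    also have "\<dots> = ennreal L * (ennreal \<bar>cdf Q1 t - cdf Q2 t\<bar> * indicator {0..} t)"
      using \<open>L \<ge> 0\<close> by (simp add: ennreal_mult ennreal_indicator)
    finally show "ennreal (norm (?f t)) \<le> ennreal L * (ennreal \<bar>cdf Q1 t - cdf Q2 t\<bar> * indicator {0..} t)" .
  qed
  also have "\<dots> = ennreal L * wasserstein Q1 Q2"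
    unfolding wasserstein_def by (intro nn_integral_cmult) simp
  finally show ?thesis .
qed

section \<open>Laws on the half-line and essential bounds\<close>

lemma nonneg_distributionD:
  assumes "nonneg_distribution Q"
  shows "real_distribution Q" "AE x in Q. 0 \<le> x"
proof -
  show rd: "real_distribution Q" using assms by (simp add: nonneg_distribution_def)
  interpret real_distribution Q by fact
  show "AE x in Q. 0 \<le> x"
    using assms prob_eq_1[of "{0..}"] by (simp add: nonneg_distribution_def)
qed

lemma tapered_eq_clamp: "1 \<le> D \<Longrightarrow> tapered D g x = g (max (1 / D) (min D x))"
proof -
  assume "1 \<le> D"
  then have "1 / D \<le> D" by (simp add: divide_le_eq) (smt (verit) mult_le_cancel_left1)
  then show ?thesis by (auto simp: tapered_def max_def min_def)
qed

lemma set_lebesgue_integral_nonneg_distribution: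
  fixes f :: "real \<Rightarrow> real"
  assumes "nonneg_distribution Q" "f \<in> borel_measurable borel"
  shows "(LINT x:{0..}|Q. f x) = (LINT x|Q. f x)"
proof -
  interpret real_distribution Q using nonneg_distributionD[OF assms(1)] by simp
  show ?thesis
    unfolding set_lebesgue_integral_def using assms(2)
    by (intro integral_cong_AE) (use nonneg_distributionD(2)[OF assms(1)] in \<open>auto simp: indicator_def\<close>)
qed

text \<open>A supremum need not belong to its set, so the lower bound is first obtained at the
  levels \<open>a - 1 / Suc n\<close> and passes to the limit on a countable intersection.\<close>

lemma (in real_distribution) AE_between_essinf_esssup:
  assumes "essinf M (\<lambda>z. ereal z) = ereal a" "esssup M (\<lambda>z. ereal z) = ereal b"
  shows "AE z in M. a \<le> z \<and> z \<le> b"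
proof -
  have up: "AE z in M. z \<le> b" using esssup_AE[of ereal M] assms by simp
  have "AE z in M. a - 1 / Suc n \<le> z" for n
  proof -
    have "ereal (a - 1 / Suc n) < Sup {z. AE x in M. z \<le> ereal x}"
      using assms(1) by (simp add: essinf_def)
    then obtain w where w: "AE x in M. w \<le> ereal x" "ereal (a - 1 / Suc n) < w"
      unfolding less_Sup_iff by auto
    from w(1) show ?thesis
    proof eventually_elim
      case (elim x) then show ?case using w(2) by (metis ereal_less_eq(3) less_imp_le order_trans)
    qed
  qed
  then have "AE z in M. \<forall>n. a - 1 / Suc n \<le> z" by (simp add: AE_all_countable)
  then have "AE z in M. a \<le> z"
  proof eventually_elim
    case (elim z)
    have "(\<lambda>n. a - 1 / Suc n) \<longlonglongrightarrow> a - 0" by (intro tendsto_intros LIMSEQ_inverse_real_of_nat[unfolded inverse_eq_divide])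
    then show ?case using elim by (intro LIMSEQ_le_const2[of "\<lambda>n. a - 1 / Suc n"]) auto
  qed
  with up show ?thesis by eventually_elim simp
qed

lemma (in real_distribution) prob_below_pos_of_essinf:
  assumes "essinf M (\<lambda>z. ereal z) = ereal a" "a < y"
  shows "0 < prob {..<y}"
proof (rule ccontr)
  assume "\<not> ?thesis"
  then have "prob {..<y} = 0" using measure_nonneg[of M "{..<y}"] by linarith
  then have "AE x in M. \<not> x < y" using prob_eq_0[of "{..<y}"] by simp
  then have "AE x in M. ereal y \<le> ereal x" by eventually_elim simp
  then have "ereal y \<le> essinf M (\<lambda>z. ereal z)" unfolding essinf_def by (intro Sup_upper) simp
  with assms show False by simp
qed

lemma (in real_distribution) prob_above_pos_of_esssup:
  assumes "esssup M (\<lambda>z. ereal z) = ereal b" "y < b"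
  shows "0 < prob {y<..}"
proof (rule ccontr)
  assume "\<not> ?thesis"
  then have "prob {y<..} = 0" using measure_nonneg[of M "{y<..}"] by linarith
  then have "AE x in M. \<not> y < x" using prob_eq_0[of "{y<..}"] by simp
  then have "AE x in M. ereal x \<le> ereal y" by eventually_elim simp
  then have "esssup M (\<lambda>z. ereal z) \<le> ereal y" by (subst esssup_eq_AE) (auto intro!: Inf_lower)
  with assms show False by simp
qed

subsection \<open>Roots of tapered moments\<close>

text \<open>Constants disappear under the root, since \<open>w powr (1 / q n)\<close> tends to 1, so
  it suffices to know \<open>J n\<close> up to factors. The hypothesis on \<open>e\<close>, used at
  1 / y, makes the error negligible against \<open>y powr q n\<close> for every y, however
  small.\<close>

lemma powr_root_limit:
  fixes J e q :: "nat \<Rightarrow> real"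
  assumes "0 < b" and q: "filterlim q at_top sequentially"
    and e: "\<And>y. 0 < y \<Longrightarrow> (\<lambda>n. e n * y powr q n) \<longlonglongrightarrow> 0"
    and lower: "\<And>y. 0 < y \<Longrightarrow> y < b \<Longrightarrow> \<exists>w>0. \<forall>\<^sub>F n in sequentially. w * y powr q n - e n \<le> J n"
    and upper: "\<forall>\<^sub>F n in sequentially. J n \<le> b powr q n + e n"
  shows "(\<lambda>n. J n powr (1 / q n)) \<longlonglongrightarrow> b"
proof -
  have qpos: "\<forall>\<^sub>F n in sequentially. 0 < q n"
    using q by (simp add: filterlim_at_top_dense)
  have inv: "(\<lambda>n. 1 / q n) \<longlonglongrightarrow> 0"
    using tendsto_inverse_0_at_top[OF q] by (simp add: inverse_eq_divide)
  have root: "(\<lambda>n. y * w powr (1 / q n)) \<longlonglongrightarrow> y" if "0 < w" for w y :: real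
  proof -
    have "(\<lambda>n. y * w powr (1 / q n)) \<longlonglongrightarrow> y * w powr 0"
      using that inv by (intro tendsto_intros) auto
    then show ?thesis using that by simp
  qed
  have inverse_powr: "y powr q n * (1 / y) powr q n = 1" if "0 < y" for y n
    using that by (simp add: powr_divide)
  have scaled: "(y powr q n * w) powr (1 / q n) = y * w powr (1 / q n)"
    if "0 < y" "0 < w" "0 < q n" for y w n
    using that by (simp add: powr_mult powr_powr)
  have low: "\<exists>w>0. \<forall>\<^sub>F n in sequentially. y powr q n * w \<le> J n" if y: "0 < y" "y < b" for y
  proof -
    obtain w where w: "w > 0" "\<forall>\<^sub>F n in sequentially. w * y powr q n - e n \<le> J n"
      using lower[OF y] by auto
    have "\<forall>\<^sub>F n in sequentially. e n * (1 / y) powr q n < w / 2"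
      using order_tendstoD(2)[OF e[of "1 / y"], of "w / 2"] w(1) y by simp
    with w(2) have "\<forall>\<^sub>F n in sequentially. y powr q n * (w / 2) \<le> J n"
    proof eventually_elim
      case (elim n)
      have "e n = y powr q n * (e n * (1 / y) powr q n)"
        using inverse_powr[OF y(1), of n] by (simp add: mult.left_commute)
      also have "\<dots> \<le> y powr q n * (w / 2)"
        using elim(2) by (intro mult_left_mono) auto
      finally show ?case using elim(1) by (simp add: algebra_simps)
    qed
    then show ?thesis using w(1) by (intro exI[of _ "w / 2"]) auto
  qed
  show ?thesis
  proof (rule order_tendstoI)
    fix a assume "a < b"
    define y where "y = (max a 0 + b) / 2"
    have y: "0 < y" "y < b" "a < y" using \<open>a < b\<close> \<open>0 < b\<close> by (auto simp: y_def)
    obtain w where w: "w > 0" "\<forall>\<^sub>F n in sequentially. y powr q n * w \<le> J n"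
      using low[OF y(1,2)] by auto
    show "\<forall>\<^sub>F n in sequentially. a < J n powr (1 / q n)"
      using order_tendstoD(1)[OF root[OF w(1)] y(3)] w(2) qpos
    proof eventually_elim
      case (elim n)
      have "(y powr q n * w) powr (1 / q n) \<le> J n powr (1 / q n)"
        using elim w(1) by (intro powr_mono2) auto
      then show ?case using elim(1) scaled[OF y(1) w(1) elim(3)] by simp
    qed
  next
    fix a assume "b < a"
    have small: "\<forall>\<^sub>F n in sequentially. e n * (1 / b) powr q n < 1"
      using order_tendstoD(2)[OF e[of "1 / b"], of 1] \<open>0 < b\<close> by simp
    \<comment> \<open>The level b / 2 serves only to show that \<open>J n\<close> is nonnegative, as
      monotonicity of \<open>powr\<close> in its base requires.\<close>
    obtain w where w: "w > 0" "\<forall>\<^sub>F n in sequentially. (b / 2) powr q n * w \<le> J n"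
      using low[of "b / 2"] \<open>0 < b\<close> by auto
    show "\<forall>\<^sub>F n in sequentially. J n powr (1 / q n) < a"
      using small w(2) order_tendstoD(2)[OF root[of 2 b] \<open>b < a\<close>, OF zero_less_numeral] upper qpos
    proof eventually_elim
      case (elim n)
      have "0 \<le> (b / 2) powr q n * w" using w(1) by simp
      then have "0 \<le> J n" using elim(2) by simp
      have "e n = b powr q n * (e n * (1 / b) powr q n)"
        using inverse_powr[OF \<open>0 < b\<close>, of n] by (simp add: mult.left_commute)
      also have "\<dots> \<le> b powr q n * 1"
        using elim(1) by (intro mult_left_mono) auto
      finally have "J n \<le> b powr q n * 2" using elim(4) by (simp add: algebra_simps)
      then have "J n powr (1 / q n) \<le> (b powr q n * 2) powr (1 / q n)"
        using \<open>0 \<le> J n\<close> elim(5) by (intro powr_mono2) auto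
      then show ?case using elim(3) scaled[OF \<open>0 < b\<close> _ elim(5), of 2] by simp
    qed
  qed
qed

text \<open>On the clamp interval \<bar>ln x\<bar> \<le> ln D, so both signs of the exponent share a
  derivative bound: \<open>\<bar>r * x powr (r - 1)\<bar>\<close> is at most q times
  \<open>exp ((q + 1) * ln D)\<close>.\<close>

lemma tapered_expectation_diff_le:
  assumes "1 \<le> D" "\<bar>r\<bar> \<le> q" and Q: "real_distribution Q1" "real_distribution Q2"
  shows "ennreal \<bar>(LINT x|Q1. tapered D (\<lambda>x. x powr r) x) - (LINT x|Q2. tapered D (\<lambda>x. x powr r) x)\<bar>
     \<le> ennreal (q * D powr (q + 1)) * wasserstein Q1 Q2"
proof -
  have D: "0 < 1 / D" "1 / D \<le> D"
    using \<open>1 \<le> D\<close> mult_mono[of 1 D 1 D] by (auto simp: divide_le_eq)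
  show ?thesis
    unfolding tapered_eq_clamp[OF \<open>1 \<le> D\<close>]
  proof (rule clamp_expectation_diff_le_wasserstein[OF _ D(2) _ _ _ Q])
    fix x assume x: "1 / D \<le> x" "x \<le> D"
    with D have "0 < x" by linarith
    then show "DERIV (\<lambda>x. x powr r) x :> r * x powr (r - 1)"
      by (auto intro!: derivative_eq_intros)
    show "isCont (\<lambda>x. r * x powr (r - 1)) x" using \<open>0 < x\<close> by (intro continuous_intros) auto
    have "\<bar>ln x\<bar> \<le> ln D"
    proof -
      have "0 < D" using D by linarith
      have "ln (1 / D) \<le> ln x" "ln x \<le> ln D"
        by (rule iffD2[OF ln_le_cancel_iff], fact D(1), fact \<open>0 < x\<close>, fact x(1))
           (rule iffD2[OF ln_le_cancel_iff], fact \<open>0 < x\<close>, fact \<open>0 < D\<close>, fact x(2))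
      then show ?thesis using \<open>1 \<le> D\<close> by (simp add: ln_div abs_le_iff)
    qed
    then have "\<bar>(r - 1) * ln x\<bar> \<le> (q + 1) * ln D"
      unfolding abs_mult using assms(2) by (intro mult_mono) auto
    then have "x powr (r - 1) \<le> D powr (q + 1)"
      using \<open>0 < x\<close> \<open>1 \<le> D\<close> by (simp add: powr_def)
    then show "\<bar>r * x powr (r - 1)\<bar> \<le> q * D powr (q + 1)"
      unfolding abs_mult using assms(2) by (intro mult_mono) auto
  qed (use D in simp)
qed

lemma eventually_le_powr_minus_of_scaled_tendsto_0:
  fixes W :: "nat \<Rightarrow> ennreal"
  assumes "(\<lambda>n. ennreal (real n powr s) * W n) \<longlonglongrightarrow> 0"
  shows "\<forall>\<^sub>F n in sequentially. W n \<le> ennreal (real n powr - s)"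
proof -
  have "\<forall>\<^sub>F n in sequentially. ennreal (real n powr s) * W n < 1"
    using order_tendstoD(2)[OF assms] by simp
  then show ?thesis using eventually_gt_at_top[of 0]
  proof eventually_elim
    case (elim n)
    have "W n = ennreal (real n powr - s) * (ennreal (real n powr s) * W n)"
      using elim(2) by (simp add: mult.assoc[symmetric] ennreal_mult[symmetric] powr_add[symmetric])
    also have "\<dots> \<le> ennreal (real n powr - s) * 1"
      using elim(1) by (intro mult_left_mono) auto
    finally show ?case by simp
  qed
qed

text \<open>Both limits of the theorem concern the essential supremum b of
  \<open>z powr \<sigma>\<close>: it is \<open>c_hi\<close> for \<sigma> = 1 and
  \<open>1 / c_lo\<close> for \<sigma> = -1. Hypothesis \<open>pos\<close> says that no smaller
  level bounds \<open>z powr \<sigma>\<close>.\<close>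

lemma tapered_root_limit:
  fixes Q :: "nat \<Rightarrow> real measure" and \<sigma> s b c_lo c_hi :: real
  defines "q \<equiv> \<lambda>n. ln (real n) / ln (ln (real n))"
  defines "D \<equiv> \<lambda>n. real n powr (s / (2 * q n))"
  assumes \<sigma>: "\<bar>\<sigma>\<bar> = 1" and "0 < s" "real_distribution P"
    and "0 < c_lo" "AE z in P. c_lo \<le> z \<and> z \<le> c_hi"
    and "0 < b" "AE z in P. z powr \<sigma> \<le> b"
    and pos: "\<And>y. 0 < y \<Longrightarrow> y < b \<Longrightarrow> 0 < measure P {z. y < z powr \<sigma>}"
    and Q: "\<forall>\<^sub>F n in sequentially. nonneg_distribution (Q n)"
    and W: "(\<lambda>n. ennreal (real n powr s) * wasserstein (Q n) P) \<longlonglongrightarrow> 0"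
  shows "(\<lambda>n. (LINT x:{0..}|Q n. tapered (D n) (\<lambda>x. x powr (\<sigma> * q n)) x) powr (1 / q n)) \<longlonglongrightarrow> b"
proof -
  interpret P: real_distribution P by fact
  have q: "filterlim q at_top sequentially" unfolding q_def by real_asymp
  have D: "filterlim D at_top sequentially" unfolding D_def q_def using \<open>0 < s\<close> by real_asymp
  have qpos: "\<forall>\<^sub>F n in sequentially. 0 < q n"
    using q by (simp add: filterlim_at_top_dense)
  \<comment> \<open>Beyond this threshold \<open>[1 / D n, D n]\<close> contains
    \<open>[c_lo, c_hi]\<close>, so the taper changes nothing almost everywhere under
    \<open>P\<close>; the 1 supplies the condition \<open>1 \<le> D\<close> of the Lipschitz
    bound.\<close>
  have Dlarge: "\<forall>\<^sub>F n in sequentially. max (1 / c_lo) (max c_hi 1) \<le> D n"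
    using D unfolding filterlim_at_top by blast
  define e where "e n = q n * D n powr (q n + 1) * real n powr - s" for n
  let ?J = "\<lambda>n. LINT x|Q n. tapered (D n) (\<lambda>x. x powr (\<sigma> * q n)) x"
  let ?I = "\<lambda>n. LINT x|P. tapered (D n) (\<lambda>x. x powr (\<sigma> * q n)) x"
  have diff: "\<forall>\<^sub>F n in sequentially. \<bar>?J n - ?I n\<bar> \<le> e n"
    using eventually_le_powr_minus_of_scaled_tendsto_0[OF W] Q qpos Dlarge
  proof eventually_elim
    case (elim n)
    have "ennreal \<bar>?J n - ?I n\<bar> \<le> ennreal (q n * D n powr (q n + 1)) * wasserstein (Q n) P"
      using elim \<sigma> nonneg_distributionD[of "Q n"] P.real_distribution_axioms
      by (intro tapered_expectation_diff_le) (auto simp: abs_mult)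
    also have "\<dots> \<le> ennreal (q n * D n powr (q n + 1)) * ennreal (real n powr - s)"
      by (intro mult_left_mono elim) auto
    also have "\<dots> = ennreal (e n)" using elim by (simp add: e_def ennreal_mult)
    finally show ?case using elim by (subst (asm) ennreal_le_iff) (auto simp: e_def)
  qed
  have I: "?I n = (LINT x|P. (x powr \<sigma>) powr q n)"
    "integrable P (\<lambda>x. (x powr \<sigma>) powr q n)"
    if "max (1 / c_lo) (max c_hi 1) \<le> D n" "0 < q n" for n
  proof -
    have [measurable]: "tapered (D n) (\<lambda>x. x powr (\<sigma> * q n)) \<in> borel_measurable borel"
      unfolding tapered_def by measurable
    show "?I n = (LINT x|P. (x powr \<sigma>) powr q n)"
    proof (rule integral_cong_AE)
      show "AE x in P. tapered (D n) (\<lambda>x. x powr (\<sigma> * q n)) x = (x powr \<sigma>) powr q n"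
        using assms(7)
      proof eventually_elim
        case (elim x)
        have "1 / D n \<le> c_lo"
          using that \<open>0 < c_lo\<close> by (simp add: divide_le_eq field_simps)
        then show ?case using elim that by (auto simp: tapered_def powr_powr)
      qed
    qed auto
    show "integrable P (\<lambda>x. (x powr \<sigma>) powr q n)"
    proof (rule P.integrable_const_bound[of _ "b powr q n"])
      show "AE x in P. norm ((x powr \<sigma>) powr q n) \<le> b powr q n"
        using assms(9) by eventually_elim (use that in \<open>auto intro: powr_mono2\<close>)
    qed simp
  qed
  have "(\<lambda>n. ?J n powr (1 / q n)) \<longlonglongrightarrow> b"
  proof (rule powr_root_limit[OF \<open>0 < b\<close> q])
    show "(\<lambda>n. e n * y powr q n) \<longlonglongrightarrow> 0" if "0 < y" for y
    proof -
      \<comment> \<open>With L = ln n, \<open>D n powr q n\<close> is exactly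
        \<open>exp (s / 2 * L)\<close>, and the factor \<open>exp (- s * L)\<close> of
        \<open>e n\<close> leaves - s / 2 * L in the exponent. This beats
        \<open>ln y * (L / ln L)\<close>, which is o(L), for every y.\<close>
      define h where "h L = L / ln L * exp (s / 2 * ln L - s / 2 * L + ln y * (L / ln L))" for L :: real
      have "(h \<longlongrightarrow> 0) at_top" unfolding h_def using \<open>0 < s\<close> by real_asymp
      then have "(\<lambda>n. h (ln (real n))) \<longlonglongrightarrow> 0"
        by (rule filterlim_compose) real_asymp
      moreover have "\<forall>\<^sub>F n in sequentially. 1 < ln (real n)" by real_asymp
      then have "\<forall>\<^sub>F n in sequentially. h (ln (real n)) = e n * y powr q n"
      proof eventually_elim
        case (elim n)
        have n: "0 < real n" using elim by (cases n) auto
        have "0 < ln (ln (real n))" using elim by simp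
        then have "D n = exp (s / 2 * ln (ln (real n)))"
          using n elim by (simp add: D_def q_def powr_def field_simps)
        then have "D n powr (q n + 1) = exp ((q n + 1) * (s / 2 * ln (ln (real n))))"
          by (simp add: powr_def)
        also have "(q n + 1) * (s / 2 * ln (ln (real n))) = s / 2 * ln (real n) + s / 2 * ln (ln (real n))"
          using \<open>0 < ln (ln (real n))\<close> by (simp add: q_def field_simps)
        finally show ?case
          using n that unfolding h_def e_def
          by (simp add: powr_def exp_add[symmetric] mult.assoc) (simp add: q_def algebra_simps)
      qed
      ultimately show ?thesis by (rule Lim_transform_eventually)
    qed
    show "\<forall>\<^sub>F n in sequentially. ?J n \<le> b powr q n + e n"
      using diff qpos Dlarge
    proof eventually_elim
      case (elim n)
      have "(LINT x|P. (x powr \<sigma>) powr q n) \<le> b powr q n"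
        using assms(9) I(2)[OF elim(3,2)]
        by (intro P.integral_le_const) (auto elim!: eventually_mono intro!: powr_mono2 less_imp_le[OF elim(2)])
      then show ?case using elim(1) I(1)[OF elim(3,2)] by linarith
    qed
    fix y assume y: "0 < y" "y < b"
    let ?S = "{z. y < z powr \<sigma>}"
    show "\<exists>w>0. \<forall>\<^sub>F n in sequentially. w * y powr q n - e n \<le> ?J n"
    proof (intro exI[of _ "measure P ?S"] conjI pos[OF y])
      show "\<forall>\<^sub>F n in sequentially. measure P ?S * y powr q n - e n \<le> ?J n"
        using diff qpos Dlarge
      proof eventually_elim
        case (elim n)
        have [measurable]: "?S \<in> sets borel" by measurable
        have "measure P ?S * y powr q n = (LINT x|P. y powr q n * indicator ?S x)" by simp
        also have "\<dots> \<le> (LINT x|P. (x powr \<sigma>) powr q n)"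
        proof (rule integral_mono[OF _ I(2)[OF elim(3,2)]])
          show "integrable P (\<lambda>x. y powr q n * indicator ?S x)"
            by (intro integrable_mult_right) (simp add: integrable_indicator_iff less_top[symmetric])
          show "y powr q n * indicator ?S x \<le> (x powr \<sigma>) powr q n" for x
            using y elim(2) by (auto simp: indicator_def intro!: powr_mono2)
        qed
        finally show ?case using elim(1) I(1)[OF elim(3,2)] by linarith
      qed
    qed
  qed
  moreover have "\<forall>\<^sub>F n in sequentially. ?J n powr (1 / q n)
      = (LINT x:{0..}|Q n. tapered (D n) (\<lambda>x. x powr (\<sigma> * q n)) x) powr (1 / q n)"
    using Q
  proof eventually_elim
    case (elim n)
    have [measurable]: "tapered (D n) (\<lambda>x. x powr (\<sigma> * q n)) \<in> borel_measurable borel"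
      unfolding tapered_def by measurable
    show ?case by (subst set_lebesgue_integral_nonneg_distribution[OF elim]) auto
  qed
  ultimately show ?thesis by (rule Lim_transform_eventually)
qed

subsection \<open>Concentration for independent samples\<close>

text \<open>The support is finite, so the oscillation bound confines \<open>f\<close> between an
  attained minimum and an attained maximum at distance at most c, and Hoeffding's lemma applies to
  that interval.\<close>

lemma measure_pmf_mgf_le:
  fixes f :: "'a \<Rightarrow> real"
  assumes fin: "finite (set_pmf p)" and "0 < l"
    and osc: "\<And>x y. x \<in> set_pmf p \<Longrightarrow> y \<in> set_pmf p \<Longrightarrow> \<bar>f x - f y\<bar> \<le> c"
  shows "measure_pmf.expectation p (\<lambda>x. exp (l * (f x - measure_pmf.expectation p f)))
     \<le> exp (l\<^sup>2 * c\<^sup>2 / 8)"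
proof -
  define a where "a = Min (f ` set_pmf p)"
  define b where "b = Max (f ` set_pmf p)"
  have ne: "f ` set_pmf p \<noteq> {}" "finite (f ` set_pmf p)" using fin by (auto simp: set_pmf_not_empty)
  have "a \<in> f ` set_pmf p" "b \<in> f ` set_pmf p" unfolding a_def b_def using ne by auto
  then have "b - a \<le> c" using osc by fastforce
  have "a \<le> b" unfolding a_def b_def using ne by (meson Max_in Min_le)
  interpret interval_bounded_random_variable "measure_pmf p" f a b
    by unfold_locales (auto intro!: AE_pmfI simp: a_def b_def fin)
  have "ennreal (measure_pmf.expectation p (\<lambda>x. exp (l * (f x - measure_pmf.expectation p f))))
     = (\<integral>\<^sup>+x. ennreal (exp (l * (f x - measure_pmf.expectation p f))) \<partial>measure_pmf p)"
    using fin by (intro nn_integral_eq_integral[symmetric] integrable_measure_pmf_finite) auto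
  also have "\<dots> \<le> ennreal (exp (l\<^sup>2 * (b - a)\<^sup>2 / 8))"
    by (rule Hoeffdings_lemma_nn_integral[OF \<open>0 < l\<close>])
  also have "\<dots> \<le> ennreal (exp (l\<^sup>2 * c\<^sup>2 / 8))"
    using \<open>b - a \<le> c\<close> \<open>a \<le> b\<close>
    by (intro ennreal_leI) (auto intro!: divide_right_mono mult_left_mono power_mono)
  finally show ?thesis by simp
qed

lemma finite_set_replicate_pmf: "finite (set_pmf p) \<Longrightarrow> finite (set_pmf (replicate_pmf n p))"
  by (simp add: set_replicate_pmf lists_eq_set finite_lists_length_eq)

lemma expectation_replicate_pmf_Suc:
  fixes f :: "'a list \<Rightarrow> real"
  assumes "finite (set_pmf p)"
  shows "measure_pmf.expectation (replicate_pmf (Suc n) p) f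
    = measure_pmf.expectation p (\<lambda>x. measure_pmf.expectation (replicate_pmf n p) (\<lambda>xs. f (x # xs)))"
proof -
  have "replicate_pmf (Suc n) p = p \<bind> (\<lambda>x. map_pmf ((#) x) (replicate_pmf n p))"
    by (simp add: map_pmf_def)
  then show ?thesis
    using assms finite_set_replicate_pmf[OF assms, of n]
    by (simp add: pmf_expectation_bind integral_measure_pmf[OF assms] del: replicate_pmf.simps)
qed

text \<open>Induction over the sample replaces a martingale argument. Given the first symbol x, the
  induction hypothesis controls the deviation of \<open>f (x # xs)\<close> from its conditional mean
  \<open>g x\<close>; Hoeffding's lemma controls \<open>g\<close>, which inherits the oscillation c
  by averaging. The two exponents add up.\<close>

lemma mcdiarmid_mgf_le:
  fixes f :: "'a list \<Rightarrow> real"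
  assumes fin: "finite (set_pmf p)" and "0 < l"
    and bd: "\<And>xs ys x y. set (xs @ ys) \<subseteq> set_pmf p \<Longrightarrow> x \<in> set_pmf p \<Longrightarrow> y \<in> set_pmf p
      \<Longrightarrow> length xs + length ys + 1 = n \<Longrightarrow> \<bar>f (xs @ x # ys) - f (xs @ y # ys)\<bar> \<le> c"
  shows "measure_pmf.expectation (replicate_pmf n p)
      (\<lambda>xs. exp (l * (f xs - measure_pmf.expectation (replicate_pmf n p) f)))
     \<le> exp (l\<^sup>2 * (real n * c\<^sup>2) / 8)"
  using bd
proof (induction n arbitrary: f)
  case 0
  then show ?case by simp
next
  case (Suc n)
  let ?E = "measure_pmf.expectation (replicate_pmf n p)"
  define g where "g x = ?E (\<lambda>xs. f (x # xs))" for x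
  let ?m = "measure_pmf.expectation p g"
  note finn = finite_set_replicate_pmf[OF fin, of n]
  note int = integrable_measure_pmf_finite[OF finn]
  have m: "measure_pmf.expectation (replicate_pmf (Suc n) p) f = ?m"
    by (simp add: expectation_replicate_pmf_Suc[OF fin] g_def[abs_def] del: replicate_pmf.simps)
  have inner: "?E (\<lambda>xs. exp (l * (f (x # xs) - ?m)))
     \<le> exp (l\<^sup>2 * (real n * c\<^sup>2) / 8) * exp (l * (g x - ?m))" if "x \<in> set_pmf p" for x
  proof -
    have "?E (\<lambda>xs. exp (l * (f (x # xs) - g x))) \<le> exp (l\<^sup>2 * (real n * c\<^sup>2) / 8)"
      unfolding g_def
    proof (rule Suc.IH)
      fix xs ys :: "'a list" and u v
      assume "set (xs @ ys) \<subseteq> set_pmf p" "u \<in> set_pmf p" "v \<in> set_pmf p" "length xs + length ys + 1 = n"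
      then show "\<bar>f (x # xs @ u # ys) - f (x # xs @ v # ys)\<bar> \<le> c"
        using Suc.prems[of "x # xs" ys u v] that by simp
    qed
    moreover have "?E (\<lambda>xs. exp (l * (f (x # xs) - ?m)))
       = ?E (\<lambda>xs. exp (l * (f (x # xs) - g x))) * exp (l * (g x - ?m))"
      by (subst Bochner_Integration.integral_mult_left_zero[symmetric])
         (simp add: exp_add[symmetric] algebra_simps)
    ultimately show ?thesis by (simp add: mult_right_mono)
  qed
  have "measure_pmf.expectation (replicate_pmf (Suc n) p) (\<lambda>xs. exp (l * (f xs - ?m)))
     = measure_pmf.expectation p (\<lambda>x. ?E (\<lambda>xs. exp (l * (f (x # xs) - ?m))))"
    by (rule expectation_replicate_pmf_Suc[OF fin])
  also have "\<dots> \<le> measure_pmf.expectation p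
      (\<lambda>x. exp (l\<^sup>2 * (real n * c\<^sup>2) / 8) * exp (l * (g x - ?m)))"
    using inner by (intro integral_mono_AE integrable_measure_pmf_finite[OF fin] AE_pmfI)
  also have "\<dots> = exp (l\<^sup>2 * (real n * c\<^sup>2) / 8) * measure_pmf.expectation p (\<lambda>x. exp (l * (g x - ?m)))"
    by simp
  also have "\<dots> \<le> exp (l\<^sup>2 * (real n * c\<^sup>2) / 8) * exp (l\<^sup>2 * c\<^sup>2 / 8)"
  proof (intro mult_left_mono measure_pmf_mgf_le[OF fin \<open>0 < l\<close>])
    fix x y assume xy: "x \<in> set_pmf p" "y \<in> set_pmf p"
    have "\<bar>g x - g y\<bar> = \<bar>?E (\<lambda>xs. f (x # xs) - f (y # xs))\<bar>"
      unfolding g_def by (simp add: int)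
    also have "\<dots> \<le> ?E (\<lambda>xs. \<bar>f (x # xs) - f (y # xs)\<bar>)" by (rule integral_abs_bound)
    also have "\<dots> \<le> ?E (\<lambda>xs. c)"
    proof (intro integral_mono_AE int AE_pmfI)
      fix xs assume "xs \<in> set_pmf (replicate_pmf n p)"
      then show "\<bar>f (x # xs) - f (y # xs)\<bar> \<le> c"
        using Suc.prems[of "[]" xs x y] xy by (auto simp: set_replicate_pmf)
    qed
    finally show "\<bar>g x - g y\<bar> \<le> c" by simp
  qed simp
  also have "\<dots> = exp (l\<^sup>2 * (real (Suc n) * c\<^sup>2) / 8)"
    by (simp add: exp_add[symmetric] field_simps)
  finally show ?case unfolding m .
qed

lemma mcdiarmid_upper:
  fixes f :: "'a list \<Rightarrow> real"
  assumes fin: "finite (set_pmf p)" and "0 < c" "0 < u" "0 < n"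
    and bd: "\<And>xs ys x y. set (xs @ ys) \<subseteq> set_pmf p \<Longrightarrow> x \<in> set_pmf p \<Longrightarrow> y \<in> set_pmf p
      \<Longrightarrow> length xs + length ys + 1 = n \<Longrightarrow> \<bar>f (xs @ x # ys) - f (xs @ y # ys)\<bar> \<le> c"
  shows "measure_pmf.prob (replicate_pmf n p)
      {xs. u \<le> f xs - measure_pmf.expectation (replicate_pmf n p) f}
     \<le> exp (- 2 * u\<^sup>2 / (real n * c\<^sup>2))"
proof -
  let ?R = "replicate_pmf n p"
  let ?m = "measure_pmf.expectation ?R f"
  \<comment> \<open>This l minimises
    \<open>- l * u + l\<^sup>2 * (real n * c\<^sup>2) / 8\<close>.\<close>
  define l where "l = 4 * u / (real n * c\<^sup>2)"
  have "0 < l" using assms by (simp add: l_def)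
  note int = integrable_measure_pmf_finite[OF finite_set_replicate_pmf[OF fin, of n]]
  have mgf: "measure_pmf.expectation ?R (\<lambda>xs. exp (l * (f xs - ?m))) \<le> exp (l\<^sup>2 * (real n * c\<^sup>2) / 8)"
    using fin \<open>0 < l\<close> bd by (rule mcdiarmid_mgf_le)
  have "measure_pmf.prob ?R {xs. u \<le> f xs - ?m}
     = measure_pmf.expectation ?R (indicator {xs. u \<le> f xs - ?m})" by simp
  also have "\<dots> \<le> measure_pmf.expectation ?R (\<lambda>xs. exp (- l * u) * exp (l * (f xs - ?m)))"
  proof (intro integral_mono int)
    fix xs
    show "indicator {xs. u \<le> f xs - ?m} xs \<le> exp (- l * u) * exp (l * (f xs - ?m))"
      using \<open>0 < l\<close> by (auto simp: indicator_def exp_add[symmetric] mult_left_mono)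
  qed
  also have "\<dots> = exp (- l * u) * measure_pmf.expectation ?R (\<lambda>xs. exp (l * (f xs - ?m)))" by simp
  also have "\<dots> \<le> exp (- l * u) * exp (l\<^sup>2 * (real n * c\<^sup>2) / 8)"
    by (intro mult_left_mono mgf) auto
  also have "\<dots> = exp (- 2 * u\<^sup>2 / (real n * c\<^sup>2))"
    using assms unfolding exp_add[symmetric] l_def by (simp add: field_simps power2_eq_square)
  finally show ?thesis .
qed

lemma mcdiarmid:
  fixes f :: "'a list \<Rightarrow> real"
  assumes fin: "finite (set_pmf p)" and "0 < c" "0 < u" "0 < n"
    and bd: "\<And>xs ys x y. set (xs @ ys) \<subseteq> set_pmf p \<Longrightarrow> x \<in> set_pmf p \<Longrightarrow> y \<in> set_pmf p
      \<Longrightarrow> length xs + length ys + 1 = n \<Longrightarrow> \<bar>f (xs @ x # ys) - f (xs @ y # ys)\<bar> \<le> c"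
  shows "measure_pmf.prob (replicate_pmf n p)
      {xs. u \<le> \<bar>f xs - measure_pmf.expectation (replicate_pmf n p) f\<bar>}
     \<le> 2 * exp (- 2 * u\<^sup>2 / (real n * c\<^sup>2))"
proof -
  let ?m = "measure_pmf.expectation (replicate_pmf n p) f"
  have "\<bar>- f (xs @ x # ys) - - f (xs @ y # ys)\<bar> \<le> c"
    if "set (xs @ ys) \<subseteq> set_pmf p" "x \<in> set_pmf p" "y \<in> set_pmf p" "length xs + length ys + 1 = n"
    for xs ys x y using bd[OF that] by linarith
  from mcdiarmid_upper[OF assms(1-4), of "\<lambda>xs. - f xs", OF this]
  have "measure_pmf.prob (replicate_pmf n p) {xs. u \<le> ?m - f xs} \<le> exp (- 2 * u\<^sup>2 / (real n * c\<^sup>2))"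
    by simp
  moreover have "measure_pmf.prob (replicate_pmf n p) {xs. u \<le> f xs - ?m} \<le> exp (- 2 * u\<^sup>2 / (real n * c\<^sup>2))"
    using assms(1-4) bd by (rule mcdiarmid_upper)
  moreover have "{xs. u \<le> \<bar>f xs - ?m\<bar>} = {xs. u \<le> f xs - ?m} \<union> {xs. u \<le> ?m - f xs}"
    by auto
  moreover have "measure_pmf.prob (replicate_pmf n p) ({xs. u \<le> f xs - ?m} \<union> {xs. u \<le> ?m - f xs})
     \<le> measure_pmf.prob (replicate_pmf n p) {xs. u \<le> f xs - ?m}
     + measure_pmf.prob (replicate_pmf n p) {xs. u \<le> ?m - f xs}"
    by (rule measure_Un_le) auto
  ultimately show ?thesis by simp
qed

lemma pmf_replicate_pmf: "length xs = n \<Longrightarrow> pmf (replicate_pmf n p) xs = (\<Prod>i<n. pmf p (xs ! i))"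
proof (induction n arbitrary: xs)
  case (Suc n)
  then obtain x ys where xs: "xs = x # ys" "length ys = n" by (auto simp: length_Suc_conv)
  have "replicate_pmf (Suc n) p = map_pmf (\<lambda>(x, xs). x # xs) (pair_pmf p (replicate_pmf n p))"
    by (simp add: pair_pmf_def map_bind_pmf)
  also have "pmf \<dots> (x # ys) = pmf (pair_pmf p (replicate_pmf n p)) (x, ys)"
    using pmf_map_inj'[of "\<lambda>(x, xs). x # xs" "pair_pmf p (replicate_pmf n p)" "(x, ys)"]
    by (auto simp: inj_def)
  also have "\<dots> = pmf p x * (\<Prod>i<n. pmf p (ys ! i))" using Suc.IH[OF xs(2)] by (simp add: pmf_pair)
  finally show ?case
    using xs by (simp add: prod.lessThan_Suc_shift del: replicate_pmf.simps prod.lessThan_Suc)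
qed simp

text \<open>The covering event \<open>E\<close> is needed because \<open>S\<close> need not be measurable: the type of symbols may
  be uncountable, and only the finitely many sample lists over the support give events.\<close>

lemma iid_samples_prob_le:
  fixes X :: "nat \<Rightarrow> nat \<Rightarrow> 's \<Rightarrow> 'a" and B :: "'a list set"
  assumes iid: "iid_samples M p X" and n: "1 \<le> n" and fin: "finite (set_pmf (p n))"
  defines "S \<equiv> {\<omega> \<in> space M. \<not> set (sample_list X n \<omega>) \<subseteq> set_pmf (p n) \<or> sample_list X n \<omega> \<in> B}"
  shows "\<exists>E\<in>sets M. S \<subseteq> E \<and> measure M E \<le> measure_pmf.prob (replicate_pmf n (p n)) B"
proof -
  interpret prob_space M using iid by (simp add: iid_samples_def)
  let ?R = "replicate_pmf n (p n)"
  have indep: "indep_vars (\<lambda>_. count_space UNIV) (X n) {1..n}"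
    and law: "\<And>i. i \<in> {1..n} \<Longrightarrow> distr M (count_space UNIV) (X n i) = measure_pmf (p n)"
    using iid n by (auto simp: iid_samples_def)
  have X [measurable]: "X n i \<in> measurable M (count_space UNIV)" if "i \<in> {1..n}" for i
    using indep that by (auto simp: indep_vars_def)
  \<comment> \<open>Cylinder events of single lists; \<open>i - 1\<close> matches samples numbered
    from 1 with list positions numbered from 0.\<close>
  define F where "F xs = {\<omega> \<in> space M. \<forall>i\<in>{1..n}. X n i \<omega> = xs ! (i - 1)}" for xs
  have F_meas: "F xs \<in> sets M" for xs
    unfolding F_def by measurable
  have F_prob: "prob (F xs) = pmf ?R xs" if "length xs = n" for xs
  proof -
    have "F xs = (\<Inter>i\<in>{1..n}. X n i -` {xs ! (i - 1)} \<inter> space M)" using n by (auto simp: F_def)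
    also have "prob \<dots> = (\<Prod>i\<in>{1..n}. prob (X n i -` {xs ! (i - 1)} \<inter> space M))"
      using n by (intro indep_varsD[OF indep]) auto
    also have "\<dots> = (\<Prod>i\<in>{1..n}. pmf (p n) (xs ! (i - 1)))"
    proof (intro prod.cong refl)
      fix i assume i: "i \<in> {1..n}"
      have "prob (X n i -` {xs ! (i - 1)} \<inter> space M) = measure (distr M (count_space UNIV) (X n i)) {xs ! (i - 1)}"
        by (rule measure_distr[symmetric, OF X[OF i]]) simp
      then show "prob (X n i -` {xs ! (i - 1)} \<inter> space M) = pmf (p n) (xs ! (i - 1))"
        by (simp add: law[OF i] pmf.rep_eq)
    qed
    also have "\<dots> = (\<Prod>i<n. pmf (p n) (xs ! i))"
      by (rule prod.reindex_bij_witness[of _ Suc "\<lambda>i. i - 1"]) auto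
    finally show ?thesis using pmf_replicate_pmf[OF that] by simp
  qed
  have sample: "\<omega> \<in> F xs \<longleftrightarrow> \<omega> \<in> space M \<and> sample_list X n \<omega> = xs" if "length xs = n" for xs \<omega>
  proof -
    have "sample_list X n \<omega> = xs \<longleftrightarrow> (\<forall>j<n. X n (Suc j) \<omega> = xs ! j)"
      using that by (auto simp: sample_list_def list_eq_iff_nth_eq nth_append simp del: upt_Suc)
    also have "\<dots> \<longleftrightarrow> (\<forall>i\<in>{1..n}. X n i \<omega> = xs ! (i - 1))"
    proof (intro iffI ballI allI impI)
      fix i assume H: "\<forall>j<n. X n (Suc j) \<omega> = xs ! j" and "i \<in> {1..n}"
      then have "i - 1 < n" "Suc (i - 1) = i" by auto
      then show "X n i \<omega> = xs ! (i - 1)" using H by force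
    next
      fix j assume "\<forall>i\<in>{1..n}. X n i \<omega> = xs ! (i - 1)" "j < n"
      then show "X n (Suc j) \<omega> = xs ! j" by (auto dest!: bspec[of _ _ "Suc j"])
    qed
    finally show ?thesis by (auto simp: F_def)
  qed
  let ?G = "{xs. set xs \<subseteq> set_pmf (p n) \<and> length xs = n}"
  have finG: "finite ?G" using fin by (rule finite_lists_length_eq)
  have setR: "set_pmf ?R = ?G" by (auto simp: set_replicate_pmf lists_eq_set)
  have disj: "disjoint_family_on F G" if "G \<subseteq> ?G" for G
    unfolding disjoint_family_on_def
  proof (intro ballI impI equals0I)
    fix xs ys \<omega> assume "xs \<in> G" "ys \<in> G" "xs \<noteq> ys" "\<omega> \<in> F xs \<inter> F ys"
    then show False using that sample[of xs \<omega>] sample[of ys \<omega>] by auto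
  qed
  have prob_UN: "prob (\<Union>xs\<in>G. F xs) = measure_pmf.prob ?R G" if "G \<subseteq> ?G" for G
  proof -
    have "finite G" using finG that by (rule rev_finite_subset)
    then have "prob (\<Union>xs\<in>G. F xs) = (\<Sum>xs\<in>G. prob (F xs))"
      by (intro finite_measure_finite_Union disj that) (use F_meas in auto)
    also have "\<dots> = (\<Sum>xs\<in>G. pmf ?R xs)" using that by (intro sum.cong F_prob) auto
    also have "\<dots> = measure_pmf.prob ?R G" using \<open>finite G\<close> by (rule measure_measure_pmf_finite[symmetric])
    finally show ?thesis .
  qed
  \<comment> \<open>As a complement it also collects the samples that leave the support; these add
    no probability, because the lists over the support exhaust \<open>?R\<close>.\<close>
  let ?E = "space M - (\<Union>xs\<in>?G - B. F xs)"
  have UN_meas: "(\<Union>xs\<in>G. F xs) \<in> sets M" if "G \<subseteq> ?G" for G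
    using finG that F_meas by (intro sets.finite_UN) (auto intro: rev_finite_subset)
  have "prob ?E = 1 - measure_pmf.prob ?R (?G - B)"
    by (subst prob_compl[OF UN_meas]) (auto simp: prob_UN)
  also have "measure_pmf.prob ?R (?G - B) = measure_pmf.prob ?R (- B)"
    by (rule measure_prob_cong_0) (use setR in \<open>auto simp: set_pmf_iff\<close>)
  also have "1 - \<dots> = measure_pmf.prob ?R B"
    using measure_pmf.prob_compl[of "- B" ?R] by (simp add: Diff_eq)
  finally have "prob ?E \<le> measure_pmf.prob ?R B" by simp
  moreover have "S \<subseteq> ?E"
  proof
    fix \<omega> assume "\<omega> \<in> S"
    then show "\<omega> \<in> ?E" using sample[of _ \<omega>] by (auto simp: S_def)
  qed
  moreover have "?E \<in> sets M" using UN_meas[of "?G - B"] by auto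
  ultimately show ?thesis by blast
qed

subsection \<open>Poisson mixtures and the Good-Turing estimator\<close>

text \<open>The mean is the variable and the count the index: for fixed k, this function and
  \<open>poisson_cdf k\<close> are differentiated in x and integrated against mixing laws.\<close>

definition poisson_mass :: "nat \<Rightarrow> real \<Rightarrow> real" where
  "poisson_mass k x = x ^ k * exp (- x) / fact k"

definition poisson_cdf :: "nat \<Rightarrow> real \<Rightarrow> real" where
  "poisson_cdf k x = (\<Sum>i\<le>k. poisson_mass i x)"

lemma poisson_cdf_Suc: "poisson_cdf (Suc k) x = poisson_cdf k x + poisson_mass (Suc k) x"
  by (simp add: poisson_cdf_def)

lemma poisson_cdf_eq: "poisson_cdf k x = (\<Sum>i\<le>k. x ^ i / fact i) * exp (- x)"
  by (simp add: poisson_cdf_def poisson_mass_def sum_distrib_right)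

lemma poisson_mass_nonneg: "0 \<le> x \<Longrightarrow> 0 \<le> poisson_mass k x"
  by (simp add: poisson_mass_def)

lemma poisson_cdf_le_1: "0 \<le> x \<Longrightarrow> poisson_cdf k x \<le> 1"
proof -
  assume "0 \<le> x"
  have s: "(\<lambda>i. x ^ i / fact i) sums exp x"
    using exp_converges[of x] by (simp add: divide_inverse mult.commute)
  have "(\<Sum>i\<le>k. x ^ i / fact i) \<le> exp x"
    using \<open>0 \<le> x\<close> s by (subst sums_unique[OF s]) (intro sum_le_suminf sums_summable[OF s], auto)
  then have "(\<Sum>i\<le>k. x ^ i / fact i) * exp (- x) \<le> exp x * exp (- x)"
    by (intro mult_right_mono) auto
  then show ?thesis
    by (simp add: poisson_cdf_eq exp_add[symmetric])
qed

lemma poisson_cdf_nonneg: "0 \<le> x \<Longrightarrow> 0 \<le> poisson_cdf k x"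
  unfolding poisson_cdf_def by (intro sum_nonneg poisson_mass_nonneg)

lemma poisson_mass_le_cdf: "0 \<le> x \<Longrightarrow> poisson_mass k x \<le> poisson_cdf k x"
  by (cases k) (simp_all add: poisson_cdf_Suc poisson_cdf_nonneg, simp add: poisson_cdf_def)

lemma poisson_mass_le_1: "0 \<le> x \<Longrightarrow> poisson_mass k x \<le> 1"
  using poisson_mass_le_cdf poisson_cdf_le_1 order_trans by blast

text \<open>Markov's inequality for a Poisson variable of mean x, read off the series: each tail
  term is at most x / (k + 1) times the term before it.\<close>

lemma one_minus_poisson_cdf_le:
  assumes "0 \<le> x"
  shows "1 - poisson_cdf k x \<le> x / real (k + 1)"
proof -
  have s: "(\<lambda>i. x ^ i / fact i) sums exp x"
    using exp_converges[of x] by (simp add: divide_inverse mult.commute)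
  have tail: "summable (\<lambda>i. x ^ (i + l) / fact (i + l))" for l
    using summable_ignore_initial_segment[OF sums_summable[OF s]] .
  have "exp x - (\<Sum>i\<le>k. x ^ i / fact i) = (\<Sum>i. x ^ (i + Suc k) / fact (i + Suc k))"
    using suminf_minus_initial_segment[OF sums_summable[OF s], of "Suc k"]
    by (simp add: sums_unique[OF s, symmetric] lessThan_Suc_atMost)
  also have "\<dots> \<le> (\<Sum>i. x / real (k + 1) * (x ^ (i + k) / fact (i + k)))"
  proof (intro suminf_le summable_mult tail)
    fix i
    have "x * x ^ (i + k) / ((1 + real (i + k)) * fact (i + k)) \<le> x * x ^ (i + k) / ((1 + real k) * fact (i + k))"
      using assms by (intro divide_left_mono mult_right_mono) auto
    then show "x ^ (i + Suc k) / fact (i + Suc k) \<le> x / real (k + 1) * (x ^ (i + k) / fact (i + k))"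
      by (simp add: add.commute mult.commute)
  qed
  also have "\<dots> = x / real (k + 1) * (\<Sum>i. x ^ (i + k) / fact (i + k))"
    by (rule suminf_mult[OF tail])
  also have "\<dots> \<le> x / real (k + 1) * exp x"
  proof (intro mult_left_mono)
    have "(\<Sum>i. x ^ (i + k) / fact (i + k)) = exp x - (\<Sum>i<k. x ^ i / fact i)"
      using suminf_minus_initial_segment[OF sums_summable[OF s], of k]
      by (simp add: sums_unique[OF s, symmetric])
    then show "(\<Sum>i. x ^ (i + k) / fact (i + k)) \<le> exp x"
      using assms by (simp add: sum_nonneg)
  qed (use assms in auto)
  finally have "(exp x - (\<Sum>i\<le>k. x ^ i / fact i)) * exp (- x) \<le> x / real (k + 1) * exp x * exp (- x)"
    by (intro mult_right_mono) auto
  then show ?thesis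
    by (simp add: poisson_cdf_eq left_diff_distrib mult.assoc exp_add[symmetric])
qed

lemma DERIV_poisson_mass_Suc:
  "DERIV (poisson_mass (Suc k)) x :> poisson_mass k x - poisson_mass (Suc k) x"
proof -
  have "DERIV (\<lambda>x. x ^ Suc k * exp (- x) / fact (Suc k)) x
     :> (real (Suc k) * x ^ k * exp (- x) - x ^ Suc k * exp (- x)) / fact (Suc k)"
    by (rule derivative_eq_intros refl | simp)+
  also have "(real (Suc k) * x ^ k * exp (- x) - x ^ Suc k * exp (- x)) / fact (Suc k)
     = poisson_mass k x - poisson_mass (Suc k) x"
    by (simp add: poisson_mass_def diff_divide_distrib del: power_Suc of_nat_Suc)
  finally show ?thesis by (simp add: poisson_mass_def[abs_def])
qed

lemma DERIV_poisson_mass_0: "DERIV (poisson_mass 0) x :> - poisson_mass 0 x"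
  unfolding poisson_mass_def by (auto intro!: derivative_eq_intros)

text \<open>By \<open>DERIV_poisson_mass_Suc\<close> the derivatives of the masses telescope and
  only the last mass survives. As masses lie in [0, 1], this makes the distribution function
  1-Lipschitz in the mean.\<close>

lemma DERIV_poisson_cdf: "DERIV (poisson_cdf k) x :> - poisson_mass k x"
proof (induction k)
  case 0
  then show ?case using DERIV_poisson_mass_0 by (simp add: poisson_cdf_def[abs_def])
next
  case (Suc k)
  show ?case
    using DERIV_add[OF Suc DERIV_poisson_mass_Suc[of k x]] by (simp add: poisson_cdf_Suc[abs_def])
qed

lemma isCont_poisson_mass: "isCont (poisson_mass k) x"
  using DERIV_poisson_mass_0 DERIV_poisson_mass_Suc DERIV_isCont by (cases k) blast+

lemma borel_measurable_poisson_mass [measurable]: "poisson_mass k \<in> borel_measurable borel"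
  by (simp add: poisson_mass_def[abs_def])

lemma borel_measurable_poisson_cdf [measurable]: "poisson_cdf k \<in> borel_measurable borel"
  by (simp add: poisson_cdf_def[abs_def])

text \<open>The existential form covers k = 0, where the term of index k - 1 is missing from the
  derivative; in both cases it is a difference of numbers in [0, 1].\<close>

lemma abs_poisson_mass_deriv_le:
  assumes "0 \<le> x"
  shows "\<exists>m'. DERIV (poisson_mass k) x :> m' \<and> \<bar>m'\<bar> \<le> 1"
proof (cases k)
  case 0
  then show ?thesis
    using DERIV_poisson_mass_0[of x] poisson_mass_le_1[OF assms, of 0] poisson_mass_nonneg[OF assms, of 0]
    by (intro exI[of _ "- poisson_mass 0 x"]) auto
next
  case (Suc l)
  have "\<bar>poisson_mass l x - poisson_mass k x\<bar> \<le> 1"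
    using poisson_mass_le_1[OF assms, of l] poisson_mass_nonneg[OF assms, of l]
      poisson_mass_le_1[OF assms, of k] poisson_mass_nonneg[OF assms, of k] by linarith
  then show ?thesis using DERIV_poisson_mass_Suc[of l x] Suc by blast
qed

lemma abs_poisson_mass_diff_le:
  assumes "0 \<le> x" "0 \<le> y"
  shows "\<bar>poisson_mass k y - poisson_mass k x\<bar> \<le> \<bar>y - x\<bar>"
proof -
  obtain m' where m': "\<And>z. 0 \<le> z \<Longrightarrow> DERIV (poisson_mass k) z :> m' z" "\<And>z. 0 \<le> z \<Longrightarrow> \<bar>m' z\<bar> \<le> 1"
    using abs_poisson_mass_deriv_le[of _ k] by metis
  have "norm (poisson_mass k y - poisson_mass k x) \<le> 1 * norm (y - x)"
    by (rule field_differentiable_bound[of "{0..}" "poisson_mass k" m'])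
       (use assms m' in \<open>auto intro: has_field_derivative_at_within\<close>)
  then show ?thesis by simp
qed

lemma abs_poisson_cdf_diff_le:
  assumes "0 \<le> x" "0 \<le> y"
  shows "\<bar>poisson_cdf k y - poisson_cdf k x\<bar> \<le> \<bar>y - x\<bar>"
proof -
  have "norm (poisson_cdf k y - poisson_cdf k x) \<le> 1 * norm (y - x)"
    by (rule field_differentiable_bound[of "{0..}" "poisson_cdf k" "\<lambda>z. - poisson_mass k z"])
       (use assms in \<open>auto intro: has_field_derivative_at_within DERIV_poisson_cdf
          simp: abs_of_nonneg poisson_mass_nonneg poisson_mass_le_1\<close>)
  then show ?thesis by simp
qed

text \<open>For k > 0 the bracket is
  \<open>(1 - t) * poisson_cdf k x + t * poisson_cdf (k - 1) x\<close>, the effect of adding one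
  Bernoulli trial to a Poisson variable. One factor t is the length of the step, the other bounds
  the variation of the derivative along it.\<close>

lemma poisson_cdf_taylor:
  assumes "0 \<le> x" "0 \<le> t"
  shows "\<bar>poisson_cdf k (x + t) - (poisson_cdf k x - t * poisson_mass k x)\<bar> \<le> t\<^sup>2"
proof -
  define r where "r z = poisson_cdf k z + z * poisson_mass k x" for z
  have r': "DERIV r z :> poisson_mass k x - poisson_mass k z" for z
    unfolding r_def by (rule derivative_eq_intros DERIV_poisson_cdf refl | simp)+
  have "norm (r (x + t) - r x) \<le> t * norm (x + t - x)"
  proof (rule field_differentiable_bound[of "{x..x+t}" r "\<lambda>z. poisson_mass k x - poisson_mass k z"])
    fix z assume z: "z \<in> {x..x + t}"
    show "norm (poisson_mass k x - poisson_mass k z) \<le> t"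
      using abs_poisson_mass_diff_le[of z x k] z assms by auto
  qed (use assms r' in \<open>auto intro: has_field_derivative_at_within\<close>)
  then show ?thesis using assms by (simp add: r_def algebra_simps power2_eq_square)
qed

text \<open>The mean of \<open>f\<close> under the binomial law with parameters \<open>n\<close> and \<open>t\<close>. Conditioning on one trial
  gives the recursion, which the Poisson distribution functions satisfy up to \<open>t\<^sup>2\<close> by
  \<open>poisson_cdf_taylor\<close>.\<close>

primrec binomial_mean :: "nat \<Rightarrow> real \<Rightarrow> (nat \<Rightarrow> real) \<Rightarrow> real" where
  "binomial_mean 0 t f = f 0"
| "binomial_mean (Suc n) t f = t * binomial_mean n t (\<lambda>i. f (Suc i)) + (1 - t) * binomial_mean n t f"

lemma binomial_mean_add:
  "binomial_mean n t (\<lambda>i. f i + g i) = binomial_mean n t f + binomial_mean n t g"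
  by (induction n arbitrary: f g) (simp_all add: algebra_simps)

text \<open>Size biasing: weighting a binomial count by itself fixes one success and leaves one
  trial fewer. This is what the weight k + 1 in the Good-Turing estimator exploits.\<close>

lemma binomial_mean_size_bias:
  "binomial_mean (Suc n) t (\<lambda>i. real i * f i) = real (Suc n) * t * binomial_mean n t (\<lambda>i. f (Suc i))"
proof (induction n arbitrary: f)
  case (Suc n)
  have "binomial_mean (Suc n) t (\<lambda>i. real (Suc i) * f (Suc i))
      = binomial_mean (Suc n) t (\<lambda>i. real i * f (Suc i)) + binomial_mean (Suc n) t (\<lambda>i. f (Suc i))"
    by (subst binomial_mean_add[symmetric]) (simp add: algebra_simps)
  then have "binomial_mean (Suc (Suc n)) t (\<lambda>i. real i * f i)
      = t * (real (Suc n) * t * binomial_mean n t (\<lambda>i. f (Suc (Suc i))) + binomial_mean (Suc n) t (\<lambda>i. f (Suc i)))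
      + (1 - t) * (real (Suc n) * t * binomial_mean n t (\<lambda>i. f (Suc i)))"
    using Suc.IH[of f] Suc.IH[of "\<lambda>i. f (Suc i)"] by (simp only: binomial_mean.simps(2)[of "Suc n"])
  also have "\<dots> = real (Suc n) * t * binomial_mean (Suc n) t (\<lambda>i. f (Suc i))
      + t * binomial_mean (Suc n) t (\<lambda>i. f (Suc i))"
    by (simp add: algebra_simps)
  finally show ?case by (simp add: algebra_simps del: binomial_mean.simps)
qed simp

lemma binomial_mean_0: "binomial_mean n t (\<lambda>i. 0) = 0"
  by (induction n) auto

lemma binomial_poisson_cdf_diff:
  assumes "0 \<le> t" "t \<le> 1"
  shows "\<bar>binomial_mean n t (\<lambda>i. if i \<le> k then 1 else 0) - poisson_cdf k (real n * t)\<bar> \<le> real n * t\<^sup>2"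
proof (induction n arbitrary: k)
  case 0
  have "poisson_cdf k 0 = 1"
  proof -
    have "poisson_cdf k 0 = (\<Sum>i\<le>k. if i = 0 then 1 else 0)"
      unfolding poisson_cdf_def poisson_mass_def by (intro sum.cong) (auto simp: power_0_left)
    then show ?thesis by simp
  qed
  then show ?case by simp
next
  case (Suc n)
  let ?x = "real n * t"
  let ?B = "\<lambda>k. binomial_mean n t (\<lambda>i. if i \<le> k then 1 else 0)"
  \<comment> \<open>\<open>B'\<close> and \<open>H'\<close> are the binomial and Poisson values at k
    - 1. Both are 0 for k = 0, where truncated subtraction would give the wrong index.\<close>
  define B' where "B' = binomial_mean n t (\<lambda>i. if Suc i \<le> k then 1 else 0)"
  define H' where "H' = poisson_cdf k ?x - poisson_mass k ?x"
  have x: "0 \<le> ?x" using assms by simp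
  have B': "\<bar>B' - H'\<bar> \<le> real n * t\<^sup>2"
  proof (cases k)
    case 0
    then have "B' = 0" "H' = 0" by (simp_all add: B'_def H'_def poisson_cdf_def binomial_mean_0)
    then show ?thesis by simp
  next
    case (Suc l)
    then have "B' = ?B l" "H' = poisson_cdf l ?x" by (simp_all add: B'_def H'_def poisson_cdf_Suc)
    then show ?thesis using Suc.IH[of l] by simp
  qed
  have "binomial_mean (Suc n) t (\<lambda>i. if i \<le> k then 1 else 0) - poisson_cdf k (real (Suc n) * t)
     = t * (B' - H') + (1 - t) * (?B k - poisson_cdf k ?x)
     - (poisson_cdf k (?x + t) - (poisson_cdf k ?x - t * poisson_mass k ?x))"
    by (simp add: B'_def H'_def algebra_simps)
  also have "\<bar>\<dots>\<bar> \<le> t * (real n * t\<^sup>2) + (1 - t) * (real n * t\<^sup>2) + t\<^sup>2"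
  proof -
    have "\<bar>t * (B' - H')\<bar> \<le> t * (real n * t\<^sup>2)"
      unfolding abs_mult using assms B' by (simp add: mult_left_mono)
    moreover have "\<bar>(1 - t) * (?B k - poisson_cdf k ?x)\<bar> \<le> (1 - t) * (real n * t\<^sup>2)"
      unfolding abs_mult using assms Suc.IH[of k] by (simp add: mult_left_mono)
    ultimately show ?thesis using poisson_cdf_taylor[OF x assms(1), of k] by linarith
  qed
  also have "\<dots> = real (Suc n) * t\<^sup>2" by (simp add: algebra_simps)
  finally show ?case .
qed

section \<open>Mean and bounded differences of the Good-Turing partial sums\<close>

lemma expectation_count_list_replicate_pmf:
  assumes "finite (set_pmf p)"
  shows "measure_pmf.expectation (replicate_pmf n p) (\<lambda>xs. f (count_list xs a))
     = binomial_mean n (pmf p a) f"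
proof (induction n arbitrary: f)
  case (Suc n)
  let ?E = "measure_pmf.expectation (replicate_pmf n p)"
  have "measure_pmf.expectation (replicate_pmf (Suc n) p) (\<lambda>xs. f (count_list xs a))
     = measure_pmf.expectation p (\<lambda>x. indicator {a} x * (binomial_mean n (pmf p a) (\<lambda>i. f (Suc i))
         - binomial_mean n (pmf p a) f) + binomial_mean n (pmf p a) f)"
    unfolding expectation_replicate_pmf_Suc[OF assms]
    by (intro Bochner_Integration.integral_cong refl)
       (auto simp: Suc.IH[of f] Suc.IH[of "\<lambda>i. f (Suc i)"] indicator_def)
  also have "\<dots> = pmf p a * (binomial_mean n (pmf p a) (\<lambda>i. f (Suc i)) - binomial_mean n (pmf p a) f)
       + binomial_mean n (pmf p a) f"
    using assms by (subst Bochner_Integration.integral_add)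
      (auto intro!: integrable_measure_pmf_finite simp: pmf.rep_eq)
  finally show ?case by (simp add: algebra_simps)
qed simp

text \<open>After exchanging the sums, a symbol seen c times contributes c if 1 \<le> c \<le> k + 1
  and nothing otherwise. This exposes a function of single counts, fit for size biasing, with values
  at most k + 1.\<close>

lemma good_turing_sum:
  assumes "finite A"
  shows "(\<Sum>i\<le>k. good_turing A xs i)
     = (\<Sum>a\<in>A. real (count_list xs a) * (if count_list xs a \<le> Suc k then 1 else 0)) / real (length xs)"
proof -
  have "real ((i + 1) * num_seen A xs (i + 1))
      = (\<Sum>a\<in>A. if count_list xs a = Suc i then real (Suc i) else 0)" for i
    unfolding num_seen_def using assms by (simp add: sum.If_cases Int_def conj_commute algebra_simps)
  then have "(\<Sum>i\<le>k. good_turing A xs i)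
      = (\<Sum>i\<le>k. \<Sum>a\<in>A. if count_list xs a = Suc i then real (Suc i) else 0) / real (length xs)"
    by (simp add: good_turing_def sum_divide_distrib)
  also have "(\<Sum>i\<le>k. \<Sum>a\<in>A. if count_list xs a = Suc i then real (Suc i) else 0)
      = (\<Sum>a\<in>A. \<Sum>i\<le>k. if count_list xs a = Suc i then real (Suc i) else 0)"
    by (rule sum.swap)
  also have "\<dots> = (\<Sum>a\<in>A. real (count_list xs a) * (if count_list xs a \<le> Suc k then 1 else 0))"
  proof (intro sum.cong refl)
    fix a
    show "(\<Sum>i\<le>k. if count_list xs a = Suc i then real (Suc i) else 0)
        = real (count_list xs a) * (if count_list xs a \<le> Suc k then 1 else 0)"
      by (cases "count_list xs a") auto
  qed
  finally show ?thesis .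
qed

lemma good_turing_nonneg: "0 \<le> good_turing A xs i"
  by (simp add: good_turing_def)

lemma good_turing_sum_le_1:
  assumes "finite A"
  shows "(\<Sum>i\<le>k. good_turing A xs i) \<le> 1"
proof -
  have "(\<Sum>a\<in>A. real (count_list xs a)) \<le> real (length xs)"
  proof (induction xs)
    case (Cons x xs)
    have "(\<Sum>a\<in>A. real (count_list (x # xs) a)) = (\<Sum>a\<in>A. real (count_list xs a) + (if x = a then 1 else 0))"
      by (intro sum.cong) auto
    also have "\<dots> \<le> (\<Sum>a\<in>A. real (count_list xs a)) + 1"
      using assms by (simp add: sum.distrib)
    finally show ?case using Cons by simp
  qed simp
  moreover have "(\<Sum>a\<in>A. real (count_list xs a) * (if count_list xs a \<le> Suc k then 1 else 0))
      \<le> (\<Sum>a\<in>A. real (count_list xs a))"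
    by (intro sum_mono) auto
  ultimately have "(\<Sum>a\<in>A. real (count_list xs a) * (if count_list xs a \<le> Suc k then 1 else 0)) \<le> real (length xs)"
    by (rule order_trans[rotated])
  then show ?thesis unfolding good_turing_sum[OF assms] by (simp add: divide_le_eq_1)
qed

text \<open>Exchanging one symbol alters the counts of x and y only, and each contribution stays in
  [0, k + 1]. It may drop from k + 1 to 0 when a count passes the cut-off, so the bound has to grow
  with k.\<close>

lemma good_turing_sum_bounded_difference:
  assumes "finite A"
  shows "\<bar>(\<Sum>i\<le>k. good_turing A (xs @ x # ys) i) - (\<Sum>i\<le>k. good_turing A (xs @ y # ys) i)\<bar>
     \<le> 2 * real (k + 1) / real (length xs + length ys + 1)"
proof -
  define w where "w c = real c * (if c \<le> Suc k then 1 else 0)" for c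
  let ?d = "\<lambda>a. w (count_list (xs @ x # ys) a) - w (count_list (xs @ y # ys) a)"
  have w: "0 \<le> w c" "w c \<le> real (k + 1)" for c by (auto simp: w_def)
  have "\<bar>\<Sum>a\<in>A. ?d a\<bar> \<le> (\<Sum>a\<in>A. real (k + 1) * (if x = a then 1 else 0) + real (k + 1) * (if y = a then 1 else 0))"
  proof (intro order_trans[OF sum_abs] sum_mono)
    fix a
    show "\<bar>?d a\<bar> \<le> real (k + 1) * (if x = a then 1 else 0) + real (k + 1) * (if y = a then 1 else 0)"
      using w[of "count_list (xs @ x # ys) a"] w[of "count_list (xs @ y # ys) a"]
      by (cases "x = a"; cases "y = a") auto
  qed
  also have "\<dots> \<le> 2 * real (k + 1)"
    using assms by (simp add: sum.distrib sum_distrib_left[symmetric])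
  finally have "\<bar>\<Sum>a\<in>A. ?d a\<bar> \<le> 2 * real (k + 1)" .
  then have "\<bar>\<Sum>a\<in>A. ?d a\<bar> / real (length xs + length ys + 1) \<le> 2 * real (k + 1) / real (length xs + length ys + 1)"
    by (intro divide_right_mono) auto
  moreover have "(\<Sum>i\<le>k. good_turing A zs i) = (\<Sum>a\<in>A. w (count_list zs a)) / real (length zs)" for zs
    by (simp only: good_turing_sum[OF assms] w_def)
  then have "(\<Sum>i\<le>k. good_turing A (xs @ x # ys) i) - (\<Sum>i\<le>k. good_turing A (xs @ y # ys) i)
      = (\<Sum>a\<in>A. ?d a) / real (length xs + length ys + 1)"
    by (simp only: sum_subtractf diff_divide_distrib) simp
  ultimately show ?thesis by (simp only: abs_divide abs_of_nat)
qed

text \<open>By size biasing, a sample of size n + 1 leads to binomial laws with n trials, and the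
  factor n + 1 cancels the normalisation. The mean is thus exactly a weighted sum of binomial
  distribution functions.\<close>

lemma expectation_good_turing_sum:
  assumes "finite A" "finite (set_pmf p)"
  shows "measure_pmf.expectation (replicate_pmf (Suc n) p) (\<lambda>xs. \<Sum>i\<le>k. good_turing A xs i)
     = (\<Sum>a\<in>A. pmf p a * binomial_mean n (pmf p a) (\<lambda>i. if i \<le> k then 1 else 0))"
proof -
  let ?E = "measure_pmf.expectation (replicate_pmf (Suc n) p)"
  note int = integrable_measure_pmf_finite[OF finite_set_replicate_pmf[OF assms(2), of "Suc n"]]
  define w :: "nat \<Rightarrow> real" where "w c = real c * (if c \<le> Suc k then 1 else 0)" for c
  have "?E (\<lambda>xs. \<Sum>i\<le>k. good_turing A xs i) = ?E (\<lambda>xs. (\<Sum>a\<in>A. w (count_list xs a)) / real (Suc n))"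
    by (intro integral_cong_AE AE_pmfI)
       (auto simp: good_turing_sum[OF assms(1)] w_def set_replicate_pmf simp del: replicate_pmf.simps)
  also have "\<dots> = (\<Sum>a\<in>A. ?E (\<lambda>xs. w (count_list xs a))) / real (Suc n)"
    by (simp add: int Bochner_Integration.integral_sum del: replicate_pmf.simps)
  also have "(\<Sum>a\<in>A. ?E (\<lambda>xs. w (count_list xs a)))
      = (\<Sum>a\<in>A. real (Suc n) * (pmf p a * binomial_mean n (pmf p a) (\<lambda>i. if i \<le> k then 1 else 0)))"
  proof (intro sum.cong refl)
    fix a
    show "?E (\<lambda>xs. w (count_list xs a))
        = real (Suc n) * (pmf p a * binomial_mean n (pmf p a) (\<lambda>i. if i \<le> k then 1 else 0))"
      using binomial_mean_size_bias[of n "pmf p a" "\<lambda>c. if c \<le> Suc k then 1 else 0"]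
      unfolding expectation_count_list_replicate_pmf[OF assms(2), where f = w]
      by (simp only: w_def[abs_def] Suc_le_mono mult.assoc)
  qed
  finally show ?thesis by (simp add: sum_distrib_left[symmetric] del: replicate_pmf.simps of_nat_Suc)
qed

section \<open>Partial sums of Poisson mixtures\<close>

lemma poisson_mixture_eq:
  assumes "nonneg_distribution Q"
  shows "poisson_mixture Q k = (LINT x|Q. poisson_mass k x)"
  using set_lebesgue_integral_nonneg_distribution[OF assms borel_measurable_poisson_mass[of k]]
  by (simp add: poisson_mixture_def poisson_mass_def[abs_def])

lemma integrable_poisson_mass:
  assumes "nonneg_distribution Q"
  shows "integrable Q (poisson_mass k)"
proof -
  interpret real_distribution Q using nonneg_distributionD[OF assms] by simp
  have "AE x in Q. norm (poisson_mass k x) \<le> 1"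
    using nonneg_distributionD(2)[OF assms] by eventually_elim (simp add: poisson_mass_nonneg poisson_mass_le_1)
  then show ?thesis by (rule integrable_const_bound) simp
qed

lemma poisson_mixture_sum_eq:
  assumes "nonneg_distribution Q"
  shows "(\<Sum>i\<le>k. poisson_mixture Q i) = (LINT x|Q. poisson_cdf k x)"
  by (simp add: poisson_mixture_eq[OF assms] poisson_cdf_def integrable_poisson_mass[OF assms])

lemma poisson_mixture_nonneg:
  assumes "nonneg_distribution Q"
  shows "0 \<le> poisson_mixture Q k"
  unfolding poisson_mixture_eq[OF assms] using nonneg_distributionD(2)[OF assms]
  by (intro integral_nonneg_AE) (auto elim!: eventually_mono simp: poisson_mass_nonneg)

lemma integrable_poisson_cdf:
  assumes "nonneg_distribution Q"
  shows "integrable Q (poisson_cdf k)"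
  unfolding poisson_cdf_def[abs_def] by (intro Bochner_Integration.integrable_sum integrable_poisson_mass assms)

lemma poisson_mixture_sum_le_1:
  assumes "nonneg_distribution Q"
  shows "(\<Sum>i\<le>k. poisson_mixture Q i) \<le> 1"
proof -
  interpret real_distribution Q using nonneg_distributionD[OF assms] by simp
  show ?thesis
    unfolding poisson_mixture_sum_eq[OF assms] using nonneg_distributionD(2)[OF assms]
    by (intro integral_le_const integrable_poisson_cdf assms) (auto elim!: eventually_mono simp: poisson_cdf_le_1)
qed

lemma poisson_mixture_sum_ge:
  assumes "nonneg_distribution Q" "AE x in Q. x \<le> c"
  shows "1 - c / real (k + 1) \<le> (\<Sum>i\<le>k. poisson_mixture Q i)"
proof -
  interpret real_distribution Q using nonneg_distributionD[OF assms(1)] by simp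
  have "AE x in Q. 1 - c / real (k + 1) \<le> poisson_cdf k x"
    using nonneg_distributionD(2)[OF assms(1)] assms(2)
  proof eventually_elim
    case (elim x)
    then show ?case
      using one_minus_poisson_cdf_le[of x k] divide_right_mono[of x c "real (k + 1)"] by linarith
  qed
  then show ?thesis
    unfolding poisson_mixture_sum_eq[OF assms(1)]
    by (intro integral_ge_const integrable_poisson_cdf assms(1)) auto
qed

lemma poisson_mixture_sum_diff_le_wasserstein:
  assumes Q: "nonneg_distribution Q1" "nonneg_distribution Q2"
    and c: "0 \<le> c" "AE x in Q1. x \<le> c" "AE x in Q2. x \<le> c"
  shows "ennreal \<bar>(\<Sum>i\<le>k. poisson_mixture Q1 i) - (\<Sum>i\<le>k. poisson_mixture Q2 i)\<bar> \<le> wasserstein Q1 Q2"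
proof -
  have clamp: "(\<Sum>i\<le>k. poisson_mixture Q i) = (LINT x|Q. poisson_cdf k (max 0 (min c x)))"
    if Q: "nonneg_distribution Q" "AE x in Q. x \<le> c" for Q
  proof -
    interpret real_distribution Q using nonneg_distributionD[OF Q(1)] by simp
    show ?thesis
      unfolding poisson_mixture_sum_eq[OF Q(1)]
    proof (rule integral_cong_AE)
      show "AE x in Q. poisson_cdf k x = poisson_cdf k (max 0 (min c x))"
        using Q(2) nonneg_distributionD(2)[OF Q(1)] by eventually_elim simp
    qed auto
  qed
  have "ennreal \<bar>(LINT x|Q1. poisson_cdf k (max 0 (min c x))) - (LINT x|Q2. poisson_cdf k (max 0 (min c x)))\<bar>
      \<le> ennreal 1 * wasserstein Q1 Q2"
    by (rule clamp_expectation_diff_le_wasserstein[where g' = "\<lambda>x. - poisson_mass k x"])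
       (use c Q nonneg_distributionD in \<open>auto simp: DERIV_poisson_cdf isCont_poisson_mass
         abs_of_nonneg poisson_mass_nonneg poisson_mass_le_1\<close>)
  then show ?thesis using clamp[OF Q(1) c(2)] clamp[OF Q(2) c(3)] by simp
qed

lemma nonneg_distribution_rare_law: "nonneg_distribution (rare_law p n)"
proof -
  interpret prob_space "rare_law p n"
    unfolding rare_law_def by (rule measure_pmf.prob_space_distr) simp
  have "real_distribution (rare_law p n)"
    by unfold_locales (simp_all add: rare_law_def)
  moreover have "measure (rare_law p n) {0..} = 1"
    unfolding rare_law_def by (subst measure_distr) (auto simp: vimage_def)
  ultimately show ?thesis by (simp add: nonneg_distribution_def)
qed

lemma AE_rare_law:
  assumes "Measurable.pred borel R" "\<And>a. a \<in> set_pmf (p n) \<Longrightarrow> R (real n * pmf (p n) a)"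
  shows "AE x in rare_law p n. R x"
  unfolding rare_law_def using assms by (subst AE_distr_iff) (auto simp: AE_measure_pmf_iff pred_def)

lemma poisson_mixture_sum_rare_law:
  assumes "finite A" "set_pmf (p n) \<subseteq> A"
  shows "(\<Sum>i\<le>k. poisson_mixture (rare_law p n) i)
     = (\<Sum>a\<in>A. pmf (p n) a * poisson_cdf k (real n * pmf (p n) a))"
  unfolding poisson_mixture_sum_eq[OF nonneg_distribution_rare_law] unfolding rare_law_def
  using assms by (subst integral_distr; simp) (subst integral_measure_pmf[OF assms(1)]; auto)

lemma expectation_good_turing_sum_diff:
  assumes "finite A" "set_pmf (p n) \<subseteq> A" "1 \<le> n" "0 \<le> c"
    and c: "\<And>a. a \<in> A \<Longrightarrow> pmf (p n) a \<le> c / real n"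
  shows "\<bar>measure_pmf.expectation (replicate_pmf n (p n)) (\<lambda>xs. \<Sum>i\<le>k. good_turing A xs i)
     - (\<Sum>i\<le>k. poisson_mixture (rare_law p n) i)\<bar> \<le> (c\<^sup>2 + c) / real n"
proof -
  obtain n' where n': "n = Suc n'" using \<open>1 \<le> n\<close> by (cases n) auto
  have fin: "finite (set_pmf (p n))" using assms(1,2) by (rule rev_finite_subset)
  let ?b = "\<lambda>a. binomial_mean n' (pmf (p n) a) (\<lambda>i. if i \<le> k then 1 else 0)"
  let ?h = "\<lambda>a. poisson_cdf k (real n * pmf (p n) a)"
  \<comment> \<open>Two replacements: binomial by Poisson with n - 1 trials costs
    \<open>real n' * ?t\<^sup>2\<close>, and moving the Poisson mean from (n - 1) t to n t costs
    t.\<close>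
  have termwise: "\<bar>?b a - ?h a\<bar> \<le> (c\<^sup>2 + c) / real n" if "a \<in> A" for a
  proof -
    let ?t = "pmf (p n) a"
    have "\<bar>?b a - poisson_cdf k (real n' * ?t)\<bar> \<le> real n' * ?t\<^sup>2"
      by (rule binomial_poisson_cdf_diff) (auto simp: pmf_le_1)
    moreover have "\<bar>?h a - poisson_cdf k (real n' * ?t)\<bar> \<le> \<bar>real n * ?t - real n' * ?t\<bar>"
      by (rule abs_poisson_cdf_diff_le) auto
    moreover have "\<bar>real n * ?t - real n' * ?t\<bar> = ?t" by (simp add: n' algebra_simps)
    moreover have "?t \<le> c / real n" by (rule c[OF that])
    moreover have "real n' * ?t\<^sup>2 \<le> c\<^sup>2 / real n"
    proof -
      have "real n' * ?t\<^sup>2 \<le> real n * (c / real n)\<^sup>2"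
        using c[OF that] n' by (intro mult_mono power_mono) auto
      also have "\<dots> = c\<^sup>2 / real n" using n' by (simp add: power2_eq_square)
      finally show ?thesis .
    qed
    ultimately show ?thesis by (simp add: add_divide_distrib)
  qed
  have "measure_pmf.expectation (replicate_pmf n (p n)) (\<lambda>xs. \<Sum>i\<le>k. good_turing A xs i)
     - (\<Sum>i\<le>k. poisson_mixture (rare_law p n) i) = (\<Sum>a\<in>A. pmf (p n) a * (?b a - ?h a))"
    using expectation_good_turing_sum[OF assms(1) fin, of n' k]
      poisson_mixture_sum_rare_law[where p = p and n = n and k = k, OF assms(1,2)]
    by (simp add: n' sum_subtractf right_diff_distrib)
  also have "\<bar>\<dots>\<bar> \<le> (\<Sum>a\<in>A. pmf (p n) a * ((c\<^sup>2 + c) / real n))"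
    by (intro order_trans[OF sum_abs] sum_mono) (auto simp: abs_mult simp del: times_divide_eq_right intro!: mult_left_mono termwise)
  also have "\<dots> = (c\<^sup>2 + c) / real n"
    by (simp only: sum_distrib_right[symmetric] sum_pmf_eq_1[OF assms(1,2)])
  finally show ?thesis .
qed

section \<open>Almost sure control of the mixture gap\<close>

lemma AE_eventually_sample_list:
  fixes X :: "nat \<Rightarrow> nat \<Rightarrow> 's \<Rightarrow> 'a" and B :: "nat \<Rightarrow> 'a list set"
  assumes iid: "iid_samples M p X" and fin: "\<And>n. 1 \<le> n \<Longrightarrow> finite (set_pmf (p n))"
    and sum: "summable (\<lambda>n. measure_pmf.prob (replicate_pmf n (p n)) (B n))"
  shows "AE \<omega> in M. \<forall>\<^sub>F n in sequentially.
    set (sample_list X n \<omega>) \<subseteq> set_pmf (p n) \<and> sample_list X n \<omega> \<notin> B n"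
proof -
  interpret prob_space M using iid by (simp add: iid_samples_def)
  define S where "S n = {\<omega> \<in> space M. \<not> set (sample_list X n \<omega>) \<subseteq> set_pmf (p n) \<or> sample_list X n \<omega> \<in> B n}" for n
  have "\<exists>E. E \<in> sets M \<and> (1 \<le> n \<longrightarrow> S n \<subseteq> E)
      \<and> measure M E \<le> measure_pmf.prob (replicate_pmf n (p n)) (B n)" for n
  proof (cases "1 \<le> n")
    case True
    then show ?thesis using iid_samples_prob_le[OF iid True fin[OF True], of "B n"] by (auto simp: S_def)
  next
    case False
    then show ?thesis by (intro exI[of _ "{}"]) auto
  qed
  then obtain E where E: "\<And>n. E n \<in> sets M" "\<And>n. 1 \<le> n \<Longrightarrow> S n \<subseteq> E n"
    "\<And>n. measure M (E n) \<le> measure_pmf.prob (replicate_pmf n (p n)) (B n)" by metis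
  have "summable (\<lambda>n. measure M (E n))"
    by (rule summable_comparison_test'[OF sum]) (use E(3) in auto)
  \<comment> \<open>The convergence half of Borel-Cantelli involves only the probabilities of single
    rows, in keeping with the arbitrary joint law of the rows.\<close>
  then have "AE \<omega> in M. \<forall>\<^sub>F n in sequentially. \<omega> \<in> space M - E n"
    using E(1) by (intro borel_cantelli_AE1) (auto simp: less_top[symmetric])
  then show ?thesis
  proof eventually_elim
    case (elim \<omega>)
    then show ?case using eventually_ge_at_top[of 1]
      by eventually_elim (use E(2) in \<open>auto simp: S_def\<close>)
  qed
qed

text \<open>Beyond K both partial sums are at most 1 and, being increasing, at least
  \<open>1 - c / real (K + 1) - \<eta>\<close>, so they stay close there by themselves. Only the
  finitely many k up to K need a probabilistic bound.\<close>

lemma mixture_gap_good_turing_le: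
  assumes "finite A" "nonneg_distribution P" "0 \<le> c" "AE x in P. x \<le> c"
    and \<eta>: "\<And>k. k \<le> K \<Longrightarrow> \<bar>(\<Sum>i\<le>k. good_turing A xs i) - (\<Sum>i\<le>k. poisson_mixture P i)\<bar> \<le> \<eta>"
  shows "mixture_gap (good_turing A xs) P \<le> \<eta> + c / real (K + 1)"
  unfolding mixture_gap_def
proof (rule cSUP_least)
  fix k
  let ?F = "\<lambda>k. \<Sum>i\<le>k. poisson_mixture P i" and ?G = "\<lambda>k. \<Sum>i\<le>k. good_turing A xs i"
  show "\<bar>?F k - ?G k\<bar> \<le> \<eta> + c / real (K + 1)"
  proof (cases "k \<le> K")
    case True
    have "0 \<le> c / real (K + 1)" using \<open>0 \<le> c\<close> by simp
    then show ?thesis using \<eta>[OF True] by linarith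
  next
    case False
    then have "?F K \<le> ?F k" "?G K \<le> ?G k"
      using poisson_mixture_nonneg[OF assms(2)] by (auto intro!: sum_mono2 good_turing_nonneg)
    moreover have "?F k \<le> 1" "?G k \<le> 1"
      using poisson_mixture_sum_le_1[OF assms(2)] good_turing_sum_le_1[OF assms(1)] by auto
    ultimately show ?thesis
      using poisson_mixture_sum_ge[OF assms(2,4), of K] \<eta>[of K] by linarith
  qed
qed simp

lemma mixture_gap_bounds:
  assumes "finite A" "nonneg_distribution Q"
  shows "\<bar>(\<Sum>i\<le>k. poisson_mixture Q i) - (\<Sum>i\<le>k. good_turing A xs i)\<bar> \<le> mixture_gap (good_turing A xs) Q"
    and "0 \<le> mixture_gap (good_turing A xs) Q"
proof -
  have unit: "0 \<le> (\<Sum>i\<le>k. good_turing A xs i)" "(\<Sum>i\<le>k. good_turing A xs i) \<le> 1"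
    "0 \<le> (\<Sum>i\<le>k. poisson_mixture Q i)" "(\<Sum>i\<le>k. poisson_mixture Q i) \<le> 1" for k
    using poisson_mixture_sum_le_1[OF assms(2)] good_turing_sum_le_1[OF assms(1)]
      poisson_mixture_nonneg[OF assms(2)] by (auto intro!: sum_nonneg good_turing_nonneg)
  have bound: "\<bar>(\<Sum>i\<le>k. poisson_mixture Q i) - (\<Sum>i\<le>k. good_turing A xs i)\<bar> \<le> 1" for k
    using unit[of k] by linarith
  have "bdd_above (range (\<lambda>k. \<bar>(\<Sum>i\<le>k. poisson_mixture Q i) - (\<Sum>i\<le>k. good_turing A xs i)\<bar>))"
    by (rule bdd_aboveI2[OF bound])
  then show le: "\<bar>(\<Sum>i\<le>k. poisson_mixture Q i) - (\<Sum>i\<le>k. good_turing A xs i)\<bar> \<le> mixture_gap (good_turing A xs) Q" for k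
    unfolding mixture_gap_def by (intro cSUP_upper) auto
  show "0 \<le> mixture_gap (good_turing A xs) Q" using le[of 0] by linarith
qed

text \<open>\<open>P\<close> is itself a competitor in the infimum, so the gap of the estimate
  exceeds that of \<open>P\<close> by at most the precision; the triangle inequality through the
  Good-Turing estimate gives the factor 2.\<close>

lemma min_distance_estimate_diff_le:
  assumes "finite A" "min_distance_estimate m \<epsilon> (good_turing A xs) Q"
    and P: "nonneg_distribution P" "supported_on_at_most m P"
  shows "nonneg_distribution Q"
    and "\<bar>(\<Sum>i\<le>k. poisson_mixture Q i) - (\<Sum>i\<le>k. poisson_mixture P i)\<bar>
       \<le> 2 * mixture_gap (good_turing A xs) P + \<epsilon>"
proof -
  show Q: "nonneg_distribution Q" using assms(2) by (simp add: min_distance_estimate_def)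
  let ?S = "{Q'. nonneg_distribution Q' \<and> supported_on_at_most m Q'}"
  have "bdd_below (mixture_gap (good_turing A xs) ` ?S)"
    by (rule bdd_belowI2[of _ 0]) (use mixture_gap_bounds(2)[OF assms(1)] in auto)
  then have "(INF Q'\<in>?S. mixture_gap (good_turing A xs) Q') \<le> mixture_gap (good_turing A xs) P"
    using P by (intro cINF_lower) auto
  then have "mixture_gap (good_turing A xs) Q \<le> mixture_gap (good_turing A xs) P + \<epsilon>"
    using assms(2) by (simp add: min_distance_estimate_def)
  then show "\<bar>(\<Sum>i\<le>k. poisson_mixture Q i) - (\<Sum>i\<le>k. poisson_mixture P i)\<bar>
       \<le> 2 * mixture_gap (good_turing A xs) P + \<epsilon>"
    using mixture_gap_bounds(1)[OF assms(1) Q, where k = k and xs = xs]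
      mixture_gap_bounds(1)[OF assms(1) P(1), where k = k and xs = xs] by linarith
qed

lemma good_turing_concentration:
  assumes "finite A" "finite (set_pmf p)" "1 \<le> n" "0 < u"
  shows "measure_pmf.prob (replicate_pmf n p)
      {xs. \<exists>k\<le>K. u \<le> \<bar>(\<Sum>i\<le>k. good_turing A xs i)
         - measure_pmf.expectation (replicate_pmf n p) (\<lambda>xs. \<Sum>i\<le>k. good_turing A xs i)\<bar>}
     \<le> 2 * real (K + 1) * exp (- real n * u\<^sup>2 / (2 * (real (K + 1))\<^sup>2))"
proof -
  let ?R = "replicate_pmf n p"
  let ?B = "\<lambda>k. {xs. u \<le> \<bar>(\<Sum>i\<le>k. good_turing A xs i) - measure_pmf.expectation ?R (\<lambda>xs. \<Sum>i\<le>k. good_turing A xs i)\<bar>}"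
  \<comment> \<open>A common bounded difference for all partial sums up to K; it turns McDiarmid's
    exponent into n u^2 / (2 (K + 1)^2), and a union bound joins the K + 1 indices.\<close>
  let ?c = "2 * real (K + 1) / real n"
  have one: "measure_pmf.prob ?R (?B k) \<le> 2 * exp (- real n * u\<^sup>2 / (2 * (real (K + 1))\<^sup>2))" if "k \<le> K" for k
  proof -
    have "measure_pmf.prob ?R (?B k) \<le> 2 * exp (- 2 * u\<^sup>2 / (real n * ?c\<^sup>2))"
    proof (rule mcdiarmid)
      fix xs ys :: "'a list" and x y
      assume "length xs + length ys + 1 = n"
      then have "\<bar>(\<Sum>i\<le>k. good_turing A (xs @ x # ys) i) - (\<Sum>i\<le>k. good_turing A (xs @ y # ys) i)\<bar>
          \<le> 2 * real (k + 1) / real n"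
        using good_turing_sum_bounded_difference[OF assms(1), where k = k and xs = xs and x = x and ys = ys and y = y]
        by simp
      also have "\<dots> \<le> ?c" using \<open>k \<le> K\<close> by (intro divide_right_mono) auto
      finally show "\<bar>(\<Sum>i\<le>k. good_turing A (xs @ x # ys) i) - (\<Sum>i\<le>k. good_turing A (xs @ y # ys) i)\<bar> \<le> ?c" .
    qed (use assms in auto)
    also have "- 2 * u\<^sup>2 / (real n * ?c\<^sup>2) = - real n * u\<^sup>2 / (2 * (real (K + 1))\<^sup>2)"
      using \<open>1 \<le> n\<close> by (simp add: power2_eq_square field_simps del: of_nat_add of_nat_Suc)
    finally show ?thesis .
  qed
  have "{xs. \<exists>k\<le>K. u \<le> \<bar>(\<Sum>i\<le>k. good_turing A xs i)
         - measure_pmf.expectation ?R (\<lambda>xs. \<Sum>i\<le>k. good_turing A xs i)\<bar>} = (\<Union>k\<in>{..K}. ?B k)" by auto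
  also have "measure_pmf.prob ?R \<dots> \<le> (\<Sum>k\<le>K. measure_pmf.prob ?R (?B k))"
    by (rule measure_UNION_le) auto
  also have "\<dots> \<le> (\<Sum>k\<le>K. 2 * exp (- real n * u\<^sup>2 / (2 * (real (K + 1))\<^sup>2)))"
    by (intro sum_mono one) simp
  also have "\<dots> = 2 * real (K + 1) * exp (- real n * u\<^sup>2 / (2 * (real (K + 1))\<^sup>2))"
    by (simp add: algebra_simps)
  finally show ?thesis .
qed

text \<open>Four errors add up: the deviation n^(-1/4), the bias of order 1/n, the distance n^(-r)
  between source and limit, and the tail beyond \<open>K n\<close>, of order n^(-1/8). The slowest
  gives the exponent \<open>min r (1 / 8)\<close>; their coefficients sum to the constant.\<close>

lemma AE_mixture_gap_rate:
  fixes X :: "nat \<Rightarrow> nat \<Rightarrow> 's \<Rightarrow> 'a"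
  assumes source: "rare_events_source A p P c_lo c_hi" and iid: "iid_samples M p X"
    and P: "nonneg_distribution P" "AE z in P. z \<le> c_hi"
    and "0 < r" and W: "(\<lambda>n. ennreal (real n powr r) * wasserstein (rare_law p n) P) \<longlonglongrightarrow> 0"
  shows "AE \<omega> in M. \<forall>\<^sub>F n in sequentially.
    set (sample_list X n \<omega>) \<subseteq> A n \<and>
    mixture_gap (good_turing (A n) (sample_list X n \<omega>)) P \<le> (c_hi\<^sup>2 + 2 * c_hi + 2) * real n powr - min r (1 / 8)"
proof -
  have A: "finite (A n)" "set_pmf (p n) \<subseteq> A n" "0 \<le> c_hi"
    "\<And>a. a \<in> A n \<Longrightarrow> pmf (p n) a \<le> c_hi / real n" if "1 \<le> n" for n
    using source that by (auto simp: rare_events_source_def)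
  have "0 \<le> c_hi" using A(3)[of 1] by simp
  have fin: "finite (set_pmf (p n))" if "1 \<le> n" for n
    using A(1,2)[OF that] by (rule rev_finite_subset)
  \<comment> \<open>One sample moves the \<open>k\<close>-th partial sum by \<open>O(k / n)\<close>, so McDiarmid's inequality is only useful
    for \<open>k\<close> up to a small power of \<open>n\<close>; beyond that, both partial sums are close to \<open>1\<close>.\<close>
  define K where "K n = nat \<lfloor>real n powr (1 / 8)\<rfloor>" for n
  have K: "real n powr (1 / 8) \<le> real (K n + 1)" "real (K n + 1) \<le> 2 * real n powr (1 / 8)" if "1 \<le> n" for n
  proof -
    have one: "1 \<le> real n powr (1 / 8)" using that by (simp add: ge_one_powr_ge_zero)
    then have "real (K n + 1) = of_int \<lfloor>real n powr (1 / 8)\<rfloor> + 1" by (simp add: K_def)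
    then show "real n powr (1 / 8) \<le> real (K n + 1)" "real (K n + 1) \<le> 2 * real n powr (1 / 8)"
      using one of_int_floor_le[of "real n powr (1 / 8)"] real_of_int_floor_add_one_ge[of "real n powr (1 / 8)"]
      by linarith+
  qed
  let ?E = "\<lambda>n k. measure_pmf.expectation (replicate_pmf n (p n)) (\<lambda>xs. \<Sum>i\<le>k. good_turing (A n) xs i)"
  define B where "B n = {xs. \<exists>k\<le>K n. real n powr (- 1 / 4) \<le> \<bar>(\<Sum>i\<le>k. good_turing (A n) xs i) - ?E n k\<bar>}" for n
  \<comment> \<open>With K of order n^(1/8) and u = n^(-1/4), the concentration exponent is at least
    n * n^(-1/2) / (8 n^(1/4)) = n^(1/4) / 8, enough for summability.\<close>
  define b where "b n = 4 * real n powr (1 / 8) * exp (- (real n powr (1 / 4)) / 8)" for n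
  have prob_B: "measure_pmf.prob (replicate_pmf n (p n)) (B n) \<le> b n" if n: "1 \<le> n" for n
  proof -
    have "measure_pmf.prob (replicate_pmf n (p n)) (B n)
        \<le> 2 * real (K n + 1) * exp (- real n * (real n powr (- 1 / 4))\<^sup>2 / (2 * (real (K n + 1))\<^sup>2))"
      unfolding B_def using n by (intro good_turing_concentration A(1) fin) auto
    also have "\<dots> \<le> b n"
    proof -
      have "(real (K n + 1))\<^sup>2 \<le> (2 * real n powr (1 / 8))\<^sup>2"
        using K[OF n] by (intro power_mono) auto
      also have "\<dots> = 4 * real n powr (1 / 4)"
        using n by (simp add: power_mult_distrib powr_power)
      finally have "real n * (real n powr (- 1 / 4))\<^sup>2 / (2 * (4 * real n powr (1 / 4)))
          \<le> real n * (real n powr (- 1 / 4))\<^sup>2 / (2 * (real (K n + 1))\<^sup>2)"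
        using n by (intro divide_left_mono) auto
      also have "real n * (real n powr (- 1 / 4))\<^sup>2 = real n powr (1 / 2)"
      proof -
        have "real n * (real n powr (- 1 / 4))\<^sup>2 = real n powr 1 * real n powr (- 1 / 2)"
          using n by (simp add: powr_power)
        then show ?thesis by (simp only: powr_add[symmetric]) simp
      qed
      also have "real n powr (1 / 2) / (2 * (4 * real n powr (1 / 4))) = real n powr (1 / 4) / 8"
        using n powr_diff[of "real n" "1 / 2" "1 / 4"] by simp
      finally have e: "real n powr (1 / 4) / 8 \<le> real n powr (1 / 2) / (2 * (real (K n + 1))\<^sup>2)" .
      have "- real n * (real n powr (- 1 / 4))\<^sup>2 / (2 * (real (K n + 1))\<^sup>2)
          = - (real n powr (1 / 2) / (2 * (real (K n + 1))\<^sup>2))"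
        by (simp only: mult_minus_left minus_divide_left
            \<open>real n * (real n powr (- 1 / 4))\<^sup>2 = real n powr (1 / 2)\<close>)
      also have "\<dots> \<le> - (real n powr (1 / 4)) / 8" using e by linarith
      finally have e1: "exp (- real n * (real n powr (- 1 / 4))\<^sup>2 / (2 * (real (K n + 1))\<^sup>2))
          \<le> exp (- (real n powr (1 / 4)) / 8)" by (rule iffD2[OF exp_le_cancel_iff])
      have e2: "2 * real (K n + 1) \<le> 2 * (2 * real n powr (1 / 8))"
        using K(2)[OF n] by (rule mult_left_mono) simp
      show ?thesis unfolding b_def by (rule mult_mono) (use e2 in simp, rule e1, simp_all)
    qed
    finally show ?thesis .
  qed
  have "summable (\<lambda>n. measure_pmf.prob (replicate_pmf n (p n)) (B n))"
  proof (rule summable_comparison_test_ev)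
    have "\<forall>\<^sub>F n in sequentially. b n \<le> 1 / real n ^ 2" unfolding b_def by real_asymp
    then show "\<forall>\<^sub>F n in sequentially. norm (measure_pmf.prob (replicate_pmf n (p n)) (B n)) \<le> 1 / real n ^ 2"
      using eventually_ge_at_top[of 1]
    proof eventually_elim
      case (elim n)
      then show ?case using prob_B[of n] by simp
    qed
    show "summable (\<lambda>n. 1 / real n ^ 2)"
      using inverse_power_summable[of 2, where 'a = real] by (simp add: inverse_eq_divide)
  qed
  then have "AE \<omega> in M. \<forall>\<^sub>F n in sequentially.
      set (sample_list X n \<omega>) \<subseteq> set_pmf (p n) \<and> sample_list X n \<omega> \<notin> B n"
    using iid fin by (intro AE_eventually_sample_list)
  then show ?thesis
  proof eventually_elim
    case (elim \<omega>)
    then show ?case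
      using eventually_le_powr_minus_of_scaled_tendsto_0[OF W] eventually_ge_at_top[of 1]
    proof eventually_elim
      case (elim n)
      define xs where "xs = sample_list X n \<omega>"
      define t where "t = min r (1 / 8)"
      define N where "N = real n powr - t"
      have n: "1 \<le> n" "1 \<le> real n" using elim(3) by auto
      have xs: "set xs \<subseteq> set_pmf (p n)" "xs \<notin> B n" using elim(1) by (auto simp: xs_def)
      have pw: "real n powr - v \<le> N" if "t \<le> v" for v
        unfolding N_def using n that by (intro powr_mono) auto
      have "mixture_gap (good_turing (A n) xs) P
          \<le> (real n powr (- 1 / 4) + (c_hi\<^sup>2 + c_hi) / real n + real n powr - r) + c_hi / real (K n + 1)"
      proof (rule mixture_gap_good_turing_le[OF A(1)[OF n(1)] P(1) \<open>0 \<le> c_hi\<close> P(2)])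
        fix k assume "k \<le> K n"
        then have "\<bar>(\<Sum>i\<le>k. good_turing (A n) xs i) - ?E n k\<bar> \<le> real n powr (- 1 / 4)"
          using xs(2) unfolding B_def mem_Collect_eq by (meson linorder_le_cases)
        moreover have "\<bar>?E n k - (\<Sum>i\<le>k. poisson_mixture (rare_law p n) i)\<bar> \<le> (c_hi\<^sup>2 + c_hi) / real n"
          using A[OF n(1)] n by (intro expectation_good_turing_sum_diff) auto
        moreover have "\<bar>(\<Sum>i\<le>k. poisson_mixture (rare_law p n) i) - (\<Sum>i\<le>k. poisson_mixture P i)\<bar> \<le> real n powr - r"
        proof -
          have "AE x in rare_law p n. x \<le> c_hi"
          proof (rule AE_rare_law)
            fix a assume "a \<in> set_pmf (p n)"
            then show "real n * pmf (p n) a \<le> c_hi"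
              using A(2)[OF n(1)] A(4)[OF n(1), of a] n by (auto simp: field_simps)
          qed simp
          then have "ennreal \<bar>(\<Sum>i\<le>k. poisson_mixture (rare_law p n) i) - (\<Sum>i\<le>k. poisson_mixture P i)\<bar>
              \<le> wasserstein (rare_law p n) P"
            using P \<open>0 \<le> c_hi\<close> nonneg_distribution_rare_law
            by (intro poisson_mixture_sum_diff_le_wasserstein)
          also have "\<dots> \<le> ennreal (real n powr - r)" by (rule elim(2))
          finally show ?thesis by (subst (asm) ennreal_le_iff) auto
        qed
        ultimately show "\<bar>(\<Sum>i\<le>k. good_turing (A n) xs i) - (\<Sum>i\<le>k. poisson_mixture P i)\<bar>
            \<le> real n powr (- 1 / 4) + (c_hi\<^sup>2 + c_hi) / real n + real n powr - r" by linarith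
      qed
      also have "\<dots> \<le> (N + (c_hi\<^sup>2 + c_hi) * N + N) + c_hi * N"
      proof (intro add_mono)
        show "real n powr (- 1 / 4) \<le> N" using pw[of "1 / 4"] by (simp add: t_def)
        show "real n powr - r \<le> N" using pw[of r] by (simp add: t_def)
        have "1 / real n \<le> N" using pw[of 1] n by (simp add: t_def powr_minus_divide)
        then show "(c_hi\<^sup>2 + c_hi) / real n \<le> (c_hi\<^sup>2 + c_hi) * N"
          using \<open>0 \<le> c_hi\<close> mult_left_mono[of "1 / real n" N "c_hi\<^sup>2 + c_hi"] by simp
        have "1 / real (K n + 1) \<le> 1 / real n powr (1 / 8)"
          using K(1)[OF n(1)] n by (intro divide_left_mono) auto
        also have "\<dots> \<le> N" using pw[of "1 / 8"] by (simp add: t_def powr_minus_divide)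
        finally show "c_hi / real (K n + 1) \<le> c_hi * N"
          using \<open>0 \<le> c_hi\<close> mult_left_mono[of "1 / real (K n + 1)" N c_hi] by simp
      qed
      also have "\<dots> = (c_hi\<^sup>2 + 2 * c_hi + 2) * N" by (simp add: algebra_simps)
      finally show ?case using xs(1) A(2)[OF n(1)] unfolding xs_def N_def t_def by blast
    qed
  qed
qed

subsection \<open>Inverting Poisson mixtures of finitely supported laws\<close>

text \<open>Newton's scheme: the value at a new node is corrected by a multiple of the polynomial
  vanishing at the old nodes.\<close>

lemma poly_interpolation:
  fixes S :: "real set"
  assumes "finite S"
  shows "\<exists>p. \<forall>x\<in>S. poly p x = f x"
  using assms
proof (induction S)
  case (insert a S)
  then obtain p where p: "\<forall>x\<in>S. poly p x = f x" by auto
  define w where "w = (\<Prod>x\<in>S. [:- x, 1:])"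
  have w: "poly w y = (\<Prod>x\<in>S. y - x)" for y by (simp add: w_def poly_prod)
  have "poly w a \<noteq> 0" "\<forall>x\<in>S. poly w x = 0" using insert.hyps by (auto simp: w)
  then have "\<forall>x\<in>insert a S. poly (p + smult ((f a - poly p a) / poly w a) w) x = f x"
    using p by auto
  then show ?case by blast
qed auto

lemma abs_poly_le_power:
  fixes p :: "real poly"
  assumes "0 \<le> y"
  shows "\<bar>poly p y\<bar> \<le> (\<Sum>i\<le>degree p. \<bar>coeff p i\<bar>) * (1 + y) ^ degree p"
proof -
  have "\<bar>poly p y\<bar> \<le> (\<Sum>i\<le>degree p. \<bar>coeff p i * y ^ i\<bar>)"
    unfolding poly_altdef by (rule sum_abs)
  also have "\<dots> \<le> (\<Sum>i\<le>degree p. \<bar>coeff p i\<bar> * (1 + y) ^ degree p)"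
  proof (rule sum_mono)
    fix i assume "i \<in> {..degree p}"
    have "y ^ i \<le> (1 + y) ^ i" using assms by (intro power_mono) auto
    also have "\<dots> \<le> (1 + y) ^ degree p"
      using assms \<open>i \<in> {..degree p}\<close> by (intro power_increasing) auto
    finally show "\<bar>coeff p i * y ^ i\<bar> \<le> \<bar>coeff p i\<bar> * (1 + y) ^ degree p"
      using assms by (simp add: abs_mult mult_left_mono)
  qed
  finally show ?thesis by (simp add: sum_distrib_right)
qed

lemma poly_exp_eq_poisson_masses:
  "poly p x * exp (- x) = (\<Sum>j\<le>degree p. coeff p j * fact j * poisson_mass j x)"
  by (simp add: poly_altdef poisson_mass_def sum_distrib_right mult.assoc)

lemma borel_measurable_poly_exp [measurable]:
  "(\<lambda>x. poly p x * exp (- x) :: real) \<in> borel_measurable borel"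
  unfolding poly_exp_eq_poisson_masses by measurable

lemma integral_poly_exp:
  assumes "nonneg_distribution Q"
  shows "integrable Q (\<lambda>x. poly p x * exp (- x))"
    and "(LINT x|Q. poly p x * exp (- x)) = (\<Sum>j\<le>degree p. coeff p j * fact j * poisson_mixture Q j)"
  unfolding poly_exp_eq_poisson_masses
  using integrable_poisson_mass[OF assms] by (simp_all add: poisson_mixture_eq[OF assms])

text \<open>A mixture probability is a difference of two consecutive partial sums, whence 2 * D. The
  other factor depends on the polynomial alone, so a fixed test polynomial passes from Q to P at
  cost O(D).\<close>

lemma integral_poly_exp_diff_le:
  assumes Q: "nonneg_distribution Q" "nonneg_distribution P"
    and D: "\<And>k. \<bar>(\<Sum>i\<le>k. poisson_mixture Q i) - (\<Sum>i\<le>k. poisson_mixture P i)\<bar> \<le> D"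
  shows "\<bar>(LINT x|Q. poly p x * exp (- x)) - (LINT x|P. poly p x * exp (- x))\<bar>
     \<le> (\<Sum>j\<le>degree p. \<bar>coeff p j\<bar> * fact j) * (2 * D)"
proof -
  have mass: "\<bar>poisson_mixture Q j - poisson_mixture P j\<bar> \<le> 2 * D" for j
  proof (cases j)
    case 0
    then show ?thesis using D[of 0] by simp
  next
    case (Suc k)
    then show ?thesis using D[of k] D[of "Suc k"] by simp
  qed
  have "(LINT x|Q. poly p x * exp (- x)) - (LINT x|P. poly p x * exp (- x))
      = (\<Sum>j\<le>degree p. coeff p j * fact j * (poisson_mixture Q j - poisson_mixture P j))"
    unfolding integral_poly_exp(2)[OF Q(1)] integral_poly_exp(2)[OF Q(2)]
    by (simp add: sum_subtractf right_diff_distrib)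
  also have "\<bar>\<dots>\<bar> \<le> (\<Sum>j\<le>degree p. \<bar>coeff p j\<bar> * fact j * (2 * D))"
    using mass by (intro order_trans[OF sum_abs] sum_mono) (simp add: abs_mult mult_left_mono)
  finally show ?thesis by (simp add: sum_distrib_right)
qed

text \<open>Radius 1 is enough, because neighbourhoods of atoms are taken with \<delta> \<le> 1
  only.\<close>

lemma poly_exp_lipschitz_near:
  fixes p :: "real poly"
  shows "\<exists>L\<ge>0. \<forall>y. \<bar>y - a\<bar> \<le> 1 \<longrightarrow> \<bar>poly p y * exp (- y) - poly p a * exp (- a)\<bar> \<le> L * \<bar>y - a\<bar>"
proof -
  define g' where "g' y = poly (pderiv p) y * exp (- y) - poly p y * exp (- y)" for y
  have "compact (g' ` {a - 1..a + 1})"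
    unfolding g'_def by (intro compact_continuous_image continuous_intros) auto
  then have "bounded (g' ` {a - 1..a + 1})" by (rule compact_imp_bounded)
  then obtain L where "\<forall>v\<in>g' ` {a - 1..a + 1}. norm v \<le> L" unfolding bounded_iff ..
  then have L: "norm (g' y) \<le> L" if "y \<in> {a - 1..a + 1}" for y using that by simp
  have "L \<ge> 0" using L[of a] norm_ge_zero[of "g' a"] by (auto intro: order_trans)
  moreover have "\<bar>poly p y * exp (- y) - poly p a * exp (- a)\<bar> \<le> L * \<bar>y - a\<bar>" if "\<bar>y - a\<bar> \<le> 1" for y
  proof -
    have "norm (poly p y * exp (- y) - poly p a * exp (- a)) \<le> L * norm (y - a)"
    proof (rule field_differentiable_bound[of "{a - 1..a + 1}" "\<lambda>y. poly p y * exp (- y)" g'])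
      show "((\<lambda>y. poly p y * exp (- y)) has_field_derivative g' z) (at z within {a - 1..a + 1})" for z
        unfolding g'_def by (rule derivative_eq_intros refl | simp)+
    qed (use L that in auto)
    then show ?thesis by simp
  qed
  ultimately show ?thesis by blast
qed

text \<open>The role of \<open>p\<close> is to compare masses near the atoms \<open>S0\<close>; the error it makes away from them is
  absorbed by \<open>h\<close>, a product of even powers of the linear factors of degree at least that of \<open>p\<close>.\<close>

lemma atom_test_functions:
  fixes S0 S :: "real set"
  assumes "finite S0" "S0 \<noteq> {}" "S0 \<subseteq> {0..}"
  shows "\<exists>p h C N. 0 \<le> C \<and> (\<forall>a\<in>S0. poly p a * exp (- a) = indicator S a) \<and> (\<forall>a\<in>S0. poly h a = 0) \<and>
    (\<forall>\<delta> y. 0 < \<delta> \<and> \<delta> \<le> 1 \<and> 0 \<le> y \<longrightarrow> poly p y * exp (- y)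
      \<le> indicator {y. \<exists>a\<in>S \<inter> S0. \<bar>y - a\<bar> \<le> \<delta>} y + C * \<delta> + C * (1 / \<delta>) ^ N * (poly h y * exp (- y)))"
proof -
  obtain p where p: "\<forall>a\<in>S0. poly p a = exp a * indicator S a"
    using poly_interpolation[OF assms(1), of "\<lambda>a. exp a * indicator S a"] by blast
  define g where "g y = poly p y * exp (- y)" for y
  have g: "g a = indicator S a" if "a \<in> S0" for a
    using p that by (simp add: g_def exp_minus)
  obtain L where L: "\<And>a. 0 \<le> L a" "\<And>a y. \<bar>y - a\<bar> \<le> 1 \<Longrightarrow> \<bar>g y - g a\<bar> \<le> L a * \<bar>y - a\<bar>"
    using poly_exp_lipschitz_near[of _ p] unfolding g_def by metis
  define M where "M = degree p"
  define Cp where "Cp = (\<Sum>i\<le>M. \<bar>coeff p i\<bar>)"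
  define N where "N = 2 * (M + 1) * card S0"
  \<comment> \<open>Even multiplicities keep h nonnegative, and 2 * (M + 1) of them per atom make
    its degree N at least the degree M of p, so that it can dominate p at infinity.\<close>
  define h where "h = (\<Prod>a\<in>S0. [:- a, 1:] ^ (2 * (M + 1)))"
  have h: "poly h y = (\<Prod>a\<in>S0. (y - a) ^ (2 * (M + 1)))" for y
    unfolding h_def poly_prod poly_power by simp
  define X where "X = (\<Sum>a\<in>S0. a)"
  have X: "0 \<le> a" "a \<le> X" if "a \<in> S0" for a
    using that assms unfolding X_def by (auto intro!: member_le_sum)
  have "0 \<le> X" using X assms(2) by force
  have "0 \<le> Cp" by (simp add: Cp_def sum_nonneg)
  define C where "C = (\<Sum>a\<in>S0. L a) + Cp * (2 + X) ^ N"
  have C: "(\<Sum>a\<in>S0. L a) \<le> C" "Cp * (2 + X) ^ N \<le> C"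
    using \<open>0 \<le> Cp\<close> \<open>0 \<le> X\<close> L(1) by (auto simp: C_def sum_nonneg)
  have "0 \<le> C" using C(2) \<open>0 \<le> Cp\<close> \<open>0 \<le> X\<close> by (smt (verit) mult_nonneg_nonneg zero_le_power)
  have "0 < card S0" using assms by (simp add: card_gt_0_iff)
  have main: "g y \<le> indicator {y. \<exists>a\<in>S \<inter> S0. \<bar>y - a\<bar> \<le> \<delta>} y + C * \<delta> + C * (1 / \<delta>) ^ N * (poly h y * exp (- y))"
    if \<delta>: "0 < \<delta>" "\<delta> \<le> 1" and "0 \<le> y" for \<delta> y
  proof (cases "\<exists>a\<in>S0. \<bar>y - a\<bar> \<le> \<delta>")
    case True
    then obtain a where a: "a \<in> S0" "\<bar>y - a\<bar> \<le> \<delta>" by auto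
    have "g y \<le> g a + L a * \<bar>y - a\<bar>" using L(2)[of y a] a \<delta> by linarith
    also have "L a * \<bar>y - a\<bar> \<le> C * \<delta>"
    proof (intro mult_mono a \<open>0 \<le> C\<close>)
      show "L a \<le> C" using member_le_sum[of a S0 L] a(1) assms(1) L(1) C(1) by force
    qed auto
    also have "g a \<le> indicator {y. \<exists>a\<in>S \<inter> S0. \<bar>y - a\<bar> \<le> \<delta>} y"
      using a by (auto simp: g indicator_def)
    finally have "g y \<le> indicator {y. \<exists>a\<in>S \<inter> S0. \<bar>y - a\<bar> \<le> \<delta>} y + C * \<delta>" by simp
    moreover have "0 \<le> poly h y" unfolding h by (intro prod_nonneg zero_le_even_power) simp
    then have "0 \<le> C * (1 / \<delta>) ^ N * (poly h y * exp (- y))" using \<open>0 \<le> C\<close> \<delta> by simp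
    ultimately show ?thesis by linarith
  next
    case False
    \<comment> \<open>The bound is proportional to both \<delta> and 1 + y, so that the N linear
      factors of h yield \<open>(1 + y) ^ N\<close> as well as \<open>\<delta> ^ N\<close>. Up to y
      = 1 + X the distance \<delta> suffices; beyond that, y exceeds every atom by a fixed fraction
      of 1 + y, as the sum X bounds all atoms.\<close>
    have far: "\<delta> * (1 + y) / (2 + X) \<le> \<bar>y - a\<bar>" if "a \<in> S0" for a
    proof (cases "y \<le> 1 + X")
      case True
      have "\<delta> * (1 + y) / (2 + X) \<le> \<delta> * 1"
        using \<delta> True \<open>0 \<le> X\<close> unfolding times_divide_eq_right[symmetric]
        by (intro mult_left_mono) (auto simp: divide_le_eq)
      then show ?thesis using False that by force
    next
      case False
      have "\<delta> * (1 + y) / (2 + X) \<le> 1 * (1 + y) / (2 + X)"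
        using \<delta> \<open>0 \<le> y\<close> \<open>0 \<le> X\<close> by (intro divide_right_mono mult_right_mono) auto
      also have "\<dots> \<le> y - X"
      proof -
        have "(1 + X) * (1 + X) \<le> y * (1 + X)" using False \<open>0 \<le> X\<close> by (intro mult_right_mono) auto
        then show ?thesis using \<open>0 \<le> X\<close> by (subst pos_divide_le_eq) (simp_all add: algebra_simps)
      qed
      also have "\<dots> \<le> \<bar>y - a\<bar>" using X[OF that] by linarith
      finally show ?thesis .
    qed
    have "(\<delta> * (1 + y) / (2 + X)) ^ N = (\<Prod>a\<in>S0. (\<delta> * (1 + y) / (2 + X)) ^ (2 * (M + 1)))"
      by (simp only: N_def prod_constant power_mult)
    also have "\<dots> \<le> (\<Prod>a\<in>S0. \<bar>y - a\<bar> ^ (2 * (M + 1)))"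
      using far \<delta> \<open>0 \<le> y\<close> \<open>0 \<le> X\<close> by (intro prod_mono conjI power_mono) auto
    also have "\<dots> = poly h y" unfolding h by (intro prod.cong refl power_even_abs) simp
    finally have hge: "(\<delta> * (1 + y) / (2 + X)) ^ N \<le> poly h y" .
    have "poly p y \<le> Cp * (1 + y) ^ M"
      using abs_poly_le_power[OF \<open>0 \<le> y\<close>, of p] by (simp add: Cp_def M_def)
    also have "\<dots> \<le> Cp * (1 + y) ^ N"
    proof (intro mult_left_mono power_increasing)
      have "M * 1 \<le> 2 * (M + 1) * card S0" using \<open>0 < card S0\<close> by (intro mult_mono) auto
      then show "M \<le> N" by (simp add: N_def)
    qed (use \<open>0 \<le> y\<close> \<open>0 \<le> Cp\<close> in auto)
    also have "\<dots> = Cp * (2 + X) ^ N * (1 / \<delta>) ^ N * (\<delta> * (1 + y) / (2 + X)) ^ N"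
      using \<delta> \<open>0 \<le> X\<close> by (simp add: power_divide power_mult_distrib)
    also have "\<dots> \<le> C * (1 / \<delta>) ^ N * poly h y"
      using \<delta> \<open>0 \<le> X\<close> \<open>0 \<le> y\<close> \<open>0 \<le> C\<close> hge C(2) by (intro mult_mono) auto
    finally have "poly p y * exp (- y) \<le> C * (1 / \<delta>) ^ N * poly h y * exp (- y)"
      by (intro mult_right_mono) auto
    then have "g y \<le> C * (1 / \<delta>) ^ N * (poly h y * exp (- y))" by (simp add: g_def mult.assoc)
    moreover have "0 \<le> C * \<delta>" using \<open>0 \<le> C\<close> \<delta> by simp
    moreover have "(0::real) \<le> indicator {y. \<exists>a\<in>S \<inter> S0. \<bar>y - a\<bar> \<le> \<delta>} y" by simp
    ultimately show ?thesis by linarith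
  qed
  have "\<forall>a\<in>S0. poly h a = 0" using assms(1) by (auto simp: h prod_zero_iff)
  then show ?thesis
    using \<open>0 \<le> C\<close> g main unfolding g_def
    by (intro exI[of _ p] exI[of _ h] exI[of _ C] exI[of _ N]) auto
qed

text \<open>The pointwise bound of \<open>atom_test_functions\<close> is integrated against Q. Up to
  O(D) the integrals of the two test functions agree with those under P, which are the mass of the
  chosen atoms and 0. C and N come before Q and \<delta>, which leaves \<delta> free to be balanced
  against D.\<close>

lemma atoms_mass_le:
  assumes P: "nonneg_distribution P" "finite S0" "S0 \<subseteq> {0..}" "measure P S0 = 1"
  shows "\<exists>C N. 0 \<le> C \<and> (\<forall>Q D \<delta>. nonneg_distribution Q \<longrightarrow> 0 < \<delta> \<longrightarrow> \<delta> \<le> 1 \<longrightarrow>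
    (\<forall>k. \<bar>(\<Sum>i\<le>k. poisson_mixture Q i) - (\<Sum>i\<le>k. poisson_mixture P i)\<bar> \<le> D) \<longrightarrow>
    measure P (S \<inter> S0) \<le> measure Q {y. \<exists>a\<in>S \<inter> S0. \<bar>y - a\<bar> \<le> \<delta>} + C * (\<delta> + (1 / \<delta>) ^ N * D))"
proof -
  interpret P: real_distribution P using nonneg_distributionD[OF P(1)] by simp
  have "S0 \<noteq> {}" using P(4) by auto
  have AE_S0: "AE x in P. x \<in> S0"
    using P(2,4) by (subst P.prob_eq_1[symmetric]) (auto intro: sets.finite_UN borel_closed finite_imp_closed)
  obtain p h C N where C: "0 \<le> C" and p: "\<forall>a\<in>S0. poly p a * exp (- a) = indicator S a"
    and h: "\<forall>a\<in>S0. poly h a = 0"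
    and bound: "\<And>\<delta> y. 0 < \<delta> \<Longrightarrow> \<delta> \<le> 1 \<Longrightarrow> 0 \<le> y \<Longrightarrow> poly p y * exp (- y)
      \<le> indicator {y. \<exists>a\<in>S \<inter> S0. \<bar>y - a\<bar> \<le> \<delta>} y + C * \<delta> + C * (1 / \<delta>) ^ N * (poly h y * exp (- y))"
    using atom_test_functions[OF P(2) \<open>S0 \<noteq> {}\<close> P(3), of S] by blast
  define a where "a q = (\<Sum>j\<le>degree q. \<bar>coeff q j\<bar> * fact j)" for q :: "real poly"
  have a: "0 \<le> a q" for q by (simp add: a_def sum_nonneg)
  have meas [measurable]: "S \<inter> S0 \<in> sets borel"
    using P(2) by (intro borel_closed finite_imp_closed) auto
  have Pp: "(LINT x|P. poly p x * exp (- x)) = measure P (S \<inter> S0)"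
  proof -
    have "(LINT x|P. poly p x * exp (- x)) = (LINT x|P. indicator (S \<inter> S0) x)"
    proof (rule integral_cong_AE)
      show "AE x in P. poly p x * exp (- x) = indicator (S \<inter> S0) x"
        using AE_S0 by eventually_elim (use p in \<open>simp add: indicator_def\<close>)
    qed measurable
    then show ?thesis by simp
  qed
  have Ph: "(LINT x|P. poly h x * exp (- x)) = 0"
  proof -
    have "(LINT x|P. poly h x * exp (- x)) = (LINT x|P. 0)"
    proof (rule integral_cong_AE)
      show "AE x in P. poly h x * exp (- x) = 0"
        using AE_S0 by eventually_elim (use h in simp)
    qed measurable
    then show ?thesis by simp
  qed
  define C' where "C' = C + C * (2 * a h) + 2 * a p"
  have "measure P (S \<inter> S0) \<le> measure Q {y. \<exists>a\<in>S \<inter> S0. \<bar>y - a\<bar> \<le> \<delta>} + C' * (\<delta> + (1 / \<delta>) ^ N * D)"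
    if Q: "nonneg_distribution Q" and \<delta>: "0 < \<delta>" "\<delta> \<le> 1"
      and D: "\<And>k. \<bar>(\<Sum>i\<le>k. poisson_mixture Q i) - (\<Sum>i\<le>k. poisson_mixture P i)\<bar> \<le> D" for Q D \<delta>
  proof -
    interpret Q: real_distribution Q using nonneg_distributionD[OF Q] by simp
    let ?U = "{y. \<exists>a\<in>S \<inter> S0. \<bar>y - a\<bar> \<le> \<delta>}"
    have "?U = (\<Union>a\<in>S \<inter> S0. cball a \<delta>)" by (auto simp: dist_real_def abs_minus_commute)
    then have [measurable]: "?U \<in> sets borel"
      using P(2) by (simp only:) (intro sets.finite_UN borel_closed closed_cball; auto)
    have "0 \<le> D" using D[of 0] by simp
    have one: "1 \<le> (1 / \<delta>) ^ N" using \<delta> by (intro one_le_power) (simp add: le_divide_eq)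
    note diff = integral_poly_exp_diff_le[OF Q P(1) D, folded a_def]
    have "measure P (S \<inter> S0) \<le> (LINT x|Q. poly p x * exp (- x)) + a p * (2 * D)"
      using diff[of p] Pp by linarith
    also have "(LINT x|Q. poly p x * exp (- x))
        \<le> (LINT x|Q. indicator ?U x + C * \<delta> + C * (1 / \<delta>) ^ N * (poly h x * exp (- x)))"
    proof (rule integral_mono_AE)
      show "AE x in Q. poly p x * exp (- x)
          \<le> indicator ?U x + C * \<delta> + C * (1 / \<delta>) ^ N * (poly h x * exp (- x))"
        using nonneg_distributionD(2)[OF Q] by eventually_elim (rule bound[OF \<delta>])
    qed (auto intro!: integral_poly_exp[OF Q] Bochner_Integration.integrable_add integrable_mult_right
         simp: integrable_indicator_iff less_top[symmetric])
    also have "\<dots> = measure Q ?U + C * \<delta> + C * (1 / \<delta>) ^ N * (LINT x|Q. poly h x * exp (- x))"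
      using integral_poly_exp(1)[OF Q, of h] Q.prob_space
      by (simp add: integrable_indicator_iff less_top[symmetric])
    also have "C * (1 / \<delta>) ^ N * (LINT x|Q. poly h x * exp (- x)) \<le> C * (1 / \<delta>) ^ N * (a h * (2 * D))"
      using diff[of h] Ph C \<delta> by (intro mult_left_mono) auto
    finally have "measure P (S \<inter> S0) \<le> measure Q ?U + C * \<delta> + C * (1 / \<delta>) ^ N * (a h * (2 * D)) + a p * (2 * D)"
      by linarith
    also have "a p * (2 * D) \<le> 2 * a p * ((1 / \<delta>) ^ N * D)"
      using one a[of p] \<open>0 \<le> D\<close> mult_left_mono[OF one, of "a p * D"] by (simp add: mult.commute mult.left_commute)
    also have "measure Q ?U + C * \<delta> + C * (1 / \<delta>) ^ N * (a h * (2 * D)) + 2 * a p * ((1 / \<delta>) ^ N * D)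
        \<le> measure Q ?U + C' * (\<delta> + (1 / \<delta>) ^ N * D)"
    proof -
      have "0 \<le> (2 * C * a h + 2 * a p) * \<delta> + C * ((1 / \<delta>) ^ N * D)"
        using C a \<delta> \<open>0 \<le> D\<close> by simp
      then show ?thesis by (simp add: C'_def algebra_simps)
    qed
    finally show ?thesis by simp
  qed
  moreover have "0 \<le> C'" using C a by (simp add: C'_def)
  ultimately show ?thesis by blast
qed

text \<open>\<open>S0\<close> has finitely many subsets, so sums over \<open>Pow S0\<close> serve as
  common constants; enlarging the exponent is harmless since 1 / \<delta> \<ge> 1.\<close>

lemma atoms_mass_le_uniform:
  assumes P: "nonneg_distribution P" "finite S0" "S0 \<subseteq> {0..}" "measure P S0 = 1"
  shows "\<exists>C N. 0 \<le> C \<and> (\<forall>S Q D \<delta>. nonneg_distribution Q \<longrightarrow> 0 < \<delta> \<longrightarrow> \<delta> \<le> 1 \<longrightarrow>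
    (\<forall>k. \<bar>(\<Sum>i\<le>k. poisson_mixture Q i) - (\<Sum>i\<le>k. poisson_mixture P i)\<bar> \<le> D) \<longrightarrow> S \<subseteq> S0 \<longrightarrow>
    measure P S \<le> measure Q {y. \<exists>a\<in>S. \<bar>y - a\<bar> \<le> \<delta>} + C * (\<delta> + (1 / \<delta>) ^ N * D))"
proof -
  define R where "R S C N \<longleftrightarrow> 0 \<le> C \<and> (\<forall>Q D \<delta>. nonneg_distribution Q \<longrightarrow> 0 < \<delta> \<longrightarrow> \<delta> \<le> 1 \<longrightarrow>
    (\<forall>k. \<bar>(\<Sum>i\<le>k. poisson_mixture Q i) - (\<Sum>i\<le>k. poisson_mixture P i)\<bar> \<le> D) \<longrightarrow>
    measure P (S \<inter> S0) \<le> measure Q {y. \<exists>a\<in>S \<inter> S0. \<bar>y - a\<bar> \<le> \<delta>} + C * (\<delta> + (1 / \<delta>) ^ N * D))" for S C N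
  have "\<exists>C N. R S C N" for S unfolding R_def by (rule atoms_mass_le[OF P])
  then obtain C N where R: "\<And>S. R S (C S) (N S)" by metis
  have CN: "\<And>S. 0 \<le> C S" "\<And>S Q D \<delta>. nonneg_distribution Q \<Longrightarrow> 0 < \<delta> \<Longrightarrow> \<delta> \<le> 1 \<Longrightarrow>
    (\<forall>k. \<bar>(\<Sum>i\<le>k. poisson_mixture Q i) - (\<Sum>i\<le>k. poisson_mixture P i)\<bar> \<le> D) \<Longrightarrow>
    measure P (S \<inter> S0) \<le> measure Q {y. \<exists>a\<in>S \<inter> S0. \<bar>y - a\<bar> \<le> \<delta>} + C S * (\<delta> + (1 / \<delta>) ^ N S * D)"
    using R unfolding R_def by simp_all
  let ?C = "\<Sum>S\<in>Pow S0. C S" and ?N = "\<Sum>S\<in>Pow S0. N S"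
  have "measure P S \<le> measure Q {y. \<exists>a\<in>S. \<bar>y - a\<bar> \<le> \<delta>} + ?C * (\<delta> + (1 / \<delta>) ^ ?N * D)"
    if Q: "nonneg_distribution Q" and \<delta>: "0 < \<delta>" "\<delta> \<le> 1" and S: "S \<subseteq> S0"
      and D: "\<forall>k. \<bar>(\<Sum>i\<le>k. poisson_mixture Q i) - (\<Sum>i\<le>k. poisson_mixture P i)\<bar> \<le> D" for S Q D \<delta>
  proof -
    have "0 \<le> D" using spec[OF D, of 0] by simp
    have fin: "finite (Pow S0)" using P(2) by simp
    have "C S \<le> ?C" "N S \<le> ?N" using member_le_sum[OF _ _ fin, of S] S CN(1) by auto
    moreover have "0 \<le> ?C" using CN(1) by (simp add: sum_nonneg)
    moreover have "(1 / \<delta>) ^ N S \<le> (1 / \<delta>) ^ ?N"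
      using \<delta> \<open>N S \<le> ?N\<close> by (intro power_increasing) (auto simp: le_divide_eq)
    ultimately have "C S * (\<delta> + (1 / \<delta>) ^ N S * D) \<le> ?C * (\<delta> + (1 / \<delta>) ^ ?N * D)"
      using \<delta> \<open>0 \<le> D\<close> by (intro mult_mono add_left_mono mult_right_mono) auto
    then show ?thesis using CN(2)[OF Q \<delta> D, of S] S by (simp add: Int_absorb2)
  qed
  then show ?thesis using CN(1) by (intro exI[of _ ?C] exI[of _ ?N]) (auto simp: sum_nonneg)
qed

text \<open>When x is more than \<delta> away from all atoms, the neighbourhoods of the atoms left
  of x lie in \<open>{..x}\<close> and those of the others in \<open>{x<..}\<close>. The one-sided
  mass bound for the left atoms bounds \<open>cdf Q x\<close> from below; for the right atoms,
  through complements, from above.\<close>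

lemma cdf_diff_le_off_atoms:
  assumes P: "nonneg_distribution P" "finite S0" "S0 \<subseteq> {0..}" "measure P S0 = 1"
  shows "\<exists>C N. 0 \<le> C \<and> (\<forall>Q D \<delta> x. nonneg_distribution Q \<longrightarrow> 0 < \<delta> \<longrightarrow> \<delta> \<le> 1 \<longrightarrow>
    (\<forall>k. \<bar>(\<Sum>i\<le>k. poisson_mixture Q i) - (\<Sum>i\<le>k. poisson_mixture P i)\<bar> \<le> D) \<longrightarrow>
    (\<forall>a\<in>S0. \<delta> < \<bar>x - a\<bar>) \<longrightarrow> \<bar>cdf Q x - cdf P x\<bar> \<le> C * (\<delta> + (1 / \<delta>) ^ N * D))"
proof -
  interpret P: real_distribution P using nonneg_distributionD[OF P(1)] by simp
  have S0_meas: "S \<in> sets borel" if "S \<subseteq> S0" for S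
    using that P(2) by (intro borel_closed finite_imp_closed) (rule finite_subset)
  have AE_S0: "AE x in P. x \<in> S0"
    using P(4) S0_meas by (subst P.prob_eq_1[symmetric]) auto
  obtain C N where C: "0 \<le> C" and CN: "\<And>S Q D \<delta>. nonneg_distribution Q \<Longrightarrow> 0 < \<delta> \<Longrightarrow> \<delta> \<le> 1 \<Longrightarrow>
    (\<forall>k. \<bar>(\<Sum>i\<le>k. poisson_mixture Q i) - (\<Sum>i\<le>k. poisson_mixture P i)\<bar> \<le> D) \<Longrightarrow> S \<subseteq> S0 \<Longrightarrow>
    measure P S \<le> measure Q {y. \<exists>a\<in>S. \<bar>y - a\<bar> \<le> \<delta>} + C * (\<delta> + (1 / \<delta>) ^ N * D)"
    using atoms_mass_le_uniform[OF P] by blast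
  have "\<bar>cdf Q x - cdf P x\<bar> \<le> C * (\<delta> + (1 / \<delta>) ^ N * D)"
    if Q: "nonneg_distribution Q" and \<delta>: "0 < \<delta>" "\<delta> \<le> 1"
      and D: "\<forall>k. \<bar>(\<Sum>i\<le>k. poisson_mixture Q i) - (\<Sum>i\<le>k. poisson_mixture P i)\<bar> \<le> D"
      and x: "\<forall>a\<in>S0. \<delta> < \<bar>x - a\<bar>" for Q D \<delta> x
  proof -
    interpret Q: real_distribution Q using nonneg_distributionD[OF Q] by simp
    let ?l = "S0 \<inter> {..x}" and ?r = "S0 \<inter> {x<..}"
    have "cdf P x = measure P ?l"
      unfolding cdf_def using AE_S0 S0_meas[of ?l] by (intro P.finite_measure_eq_AE) auto
    also have "\<dots> \<le> measure Q {y. \<exists>a\<in>?l. \<bar>y - a\<bar> \<le> \<delta>} + C * (\<delta> + (1 / \<delta>) ^ N * D)"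
      by (rule CN[OF Q \<delta> D]) auto
    also have "measure Q {y. \<exists>a\<in>?l. \<bar>y - a\<bar> \<le> \<delta>} \<le> cdf Q x"
      unfolding cdf_def using x by (intro Q.finite_measure_mono) force+
    finally have 1: "cdf P x \<le> cdf Q x + C * (\<delta> + (1 / \<delta>) ^ N * D)" by simp
    have "1 - cdf P x = measure P {x<..}"
      using P.prob_compl[of "{..x}"] by (simp add: cdf_def Compl_eq_Diff_UNIV[symmetric])
    also have "\<dots> = measure P ?r"
      using AE_S0 S0_meas[of ?r] by (intro P.finite_measure_eq_AE) auto
    also have "\<dots> \<le> measure Q {y. \<exists>a\<in>?r. \<bar>y - a\<bar> \<le> \<delta>} + C * (\<delta> + (1 / \<delta>) ^ N * D)"
      by (rule CN[OF Q \<delta> D]) auto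
    also have "measure Q {y. \<exists>a\<in>?r. \<bar>y - a\<bar> \<le> \<delta>} \<le> measure Q {x<..}"
      using x by (intro Q.finite_measure_mono) force+
    also have "\<dots> = 1 - cdf Q x"
      using Q.prob_compl[of "{..x}"] by (simp add: cdf_def Compl_eq_Diff_UNIV[symmetric])
    finally show ?thesis using 1 by linarith
  qed
  then show ?thesis using C by blast
qed

text \<open>Null points are dropped so that a continuity point of \<open>cdf P\<close> cannot lie in
  the support set; negative points are among them because \<open>P\<close> lives on the
  half-line.\<close>

lemma positive_atoms:
  assumes P: "nonneg_distribution P" "supported_on_at_most m P"
  shows "\<exists>S0. finite S0 \<and> S0 \<subseteq> {0..} \<and> measure P S0 = 1 \<and> (\<forall>a\<in>S0. 0 < measure P {a})"
proof -
  interpret P: real_distribution P using nonneg_distributionD[OF P(1)] by simp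
  obtain S where S: "finite S" "measure P S = 1"
    using P(2) by (auto simp: supported_on_at_most_def)
  let ?S0 = "{a\<in>S. 0 < measure P {a}}"
  have sum: "measure P T = (\<Sum>a\<in>T. measure P {a})" if "finite T" for T
    using that by (intro P.finite_measure_eq_sum_singleton) auto
  have "measure P ?S0 = (\<Sum>a\<in>?S0. measure P {a})" "(\<Sum>a\<in>S. measure P {a}) = 1"
    using sum[of ?S0] sum[OF S(1)] S by simp_all
  moreover have "(\<Sum>a\<in>?S0. measure P {a}) = (\<Sum>a\<in>S. measure P {a})"
    using S(1) by (intro sum.mono_neutral_left) (auto simp: zero_less_measure_iff)
  moreover have "a \<ge> 0" if "0 < measure P {a}" for a
  proof (rule ccontr)
    assume "\<not> a \<ge> 0"
    then have "AE x in P. x \<notin> {a}"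
      using nonneg_distributionD(2)[OF P(1)] by (auto elim!: eventually_mono)
    then show False using that P.prob_eq_0[of "{a}"] by simp
  qed
  ultimately show ?thesis using S(1) by (intro exI[of _ ?S0]) auto
qed

lemma weak_conv_of_poisson_mixtures:
  assumes P: "nonneg_distribution P" "supported_on_at_most m P"
    and Q: "\<forall>\<^sub>F n in sequentially. nonneg_distribution (Q n) \<and>
      (\<forall>k. \<bar>(\<Sum>i\<le>k. poisson_mixture (Q n) i) - (\<Sum>i\<le>k. poisson_mixture P i)\<bar> \<le> D n)"
    and D: "D \<longlonglongrightarrow> 0"
  shows "weak_conv_m Q P"
  unfolding weak_conv_m_def weak_conv_def
proof (intro allI impI)
  fix x assume "isCont (cdf P) x"
  interpret P: real_distribution P using nonneg_distributionD[OF P(1)] by simp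
  obtain S0 where S0: "finite S0" "S0 \<subseteq> {0..}" "measure P S0 = 1" "\<forall>a\<in>S0. 0 < measure P {a}"
    using positive_atoms[OF P] by blast
  have "x \<notin> S0" using bspec[OF S0(4), of x] \<open>isCont (cdf P) x\<close> P.isCont_cdf[of x] by auto
  obtain C N where C: "0 \<le> C" and CN: "\<And>Q D \<delta> x. nonneg_distribution Q \<Longrightarrow> 0 < \<delta> \<Longrightarrow> \<delta> \<le> 1 \<Longrightarrow>
    (\<forall>k. \<bar>(\<Sum>i\<le>k. poisson_mixture Q i) - (\<Sum>i\<le>k. poisson_mixture P i)\<bar> \<le> D) \<Longrightarrow>
    (\<forall>a\<in>S0. \<delta> < \<bar>x - a\<bar>) \<Longrightarrow> \<bar>cdf Q x - cdf P x\<bar> \<le> C * (\<delta> + (1 / \<delta>) ^ N * D)"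
    using cdf_diff_le_off_atoms[OF P(1) S0(1-3)] by blast
  show "(\<lambda>n. cdf (Q n) x) \<longlonglongrightarrow> cdf P x"
  proof (rule tendstoI)
    fix e :: real assume "0 < e"
    obtain d where d: "0 < d" "\<forall>a\<in>S0. d \<le> dist x a"
      using finite_set_avoid[OF S0(1), of x] \<open>x \<notin> S0\<close> by metis
    \<comment> \<open>\<delta> is fixed before n grows: d / 2 keeps x away from the atoms, the last
      term makes C * \<delta> < e, and the remaining \<open>(1 / \<delta>) ^ N * D n\<close> then
      vanishes.\<close>
    define \<delta> where "\<delta> = min 1 (min (d / 2) (e / (2 * (C + 1))))"
    have \<delta>: "0 < \<delta>" "\<delta> \<le> 1" "\<delta> < d" "C * \<delta> < e"
    proof -
      show "0 < \<delta>" "\<delta> \<le> 1" "\<delta> < d" using d \<open>0 < e\<close> C by (auto simp: \<delta>_def)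
      have "C * \<delta> \<le> C * (e / (2 * (C + 1)))" using C by (intro mult_left_mono) (auto simp: \<delta>_def)
      also have "\<dots> < e" using C \<open>0 < e\<close> by (simp add: divide_less_eq)
      finally show "C * \<delta> < e" .
    qed
    have "(\<lambda>n. C * (\<delta> + (1 / \<delta>) ^ N * D n)) \<longlonglongrightarrow> C * (\<delta> + (1 / \<delta>) ^ N * 0)"
      by (intro tendsto_intros D)
    then have "\<forall>\<^sub>F n in sequentially. C * (\<delta> + (1 / \<delta>) ^ N * D n) < e"
      using \<delta>(4) by (intro order_tendstoD(2)) auto
    with Q show "\<forall>\<^sub>F n in sequentially. dist (cdf (Q n) x) (cdf P x) < e"
    proof eventually_elim
      case (elim n)
      have "\<bar>cdf (Q n) x - cdf P x\<bar> \<le> C * (\<delta> + (1 / \<delta>) ^ N * D n)"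
        using elim \<delta> d(2) by (intro CN) (auto simp: dist_real_def)
      then show ?case using elim(2) by (simp add: dist_real_def)
    qed
  qed
qed

text \<open>Three regions: beyond B both distribution functions are 1; around each atom the
  integrand is at most 1 on an interval of length 2 * \<delta>; elsewhere in [0, B] it is at most
  \<eta>.\<close>

lemma wasserstein_le_of_cdf_diff:
  assumes Q: "real_distribution Q" "real_distribution P"
    and S0: "finite S0" "0 \<le> B" "0 \<le> \<eta>" "0 < \<delta>"
    and B: "measure Q {..B} = 1" "measure P {..B} = 1"
    and diff: "\<And>x. \<forall>a\<in>S0. \<delta> < \<bar>x - a\<bar> \<Longrightarrow> \<bar>cdf Q x - cdf P x\<bar> \<le> \<eta>"
  shows "wasserstein Q P \<le> ennreal (B * \<eta> + 2 * \<delta> * real (card S0))"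
proof -
  interpret Q: real_distribution Q by fact
  interpret P: real_distribution P by fact
  have "wasserstein Q P
      \<le> (\<integral>\<^sup>+x. (ennreal \<eta> * indicator {0..B} x + (\<Sum>a\<in>S0. indicator {a - \<delta>..a + \<delta>} x)) \<partial>lborel)"
    unfolding wasserstein_def
  proof (intro nn_integral_mono)
    fix x :: real
    consider "x < 0" | "B \<le> x" | a where "a \<in> S0" "\<bar>x - a\<bar> \<le> \<delta>"
      | "0 \<le> x" "x \<le> B" "\<forall>a\<in>S0. \<delta> < \<bar>x - a\<bar>" by force
    then show "ennreal \<bar>cdf Q x - cdf P x\<bar> * indicator {0..} x
        \<le> ennreal \<eta> * indicator {0..B} x + (\<Sum>a\<in>S0. indicator {a - \<delta>..a + \<delta>} x)"
    proof cases
      case 2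
      have "cdf Q B \<le> cdf Q x" "cdf P B \<le> cdf P x"
        using 2 by (auto intro: Q.cdf_nondecreasing P.cdf_nondecreasing)
      then have "cdf Q x = 1" "cdf P x = 1"
        using B Q.cdf_bounded_prob[of x] P.cdf_bounded_prob[of x] by (auto simp: cdf_def intro!: antisym)
      then show ?thesis by simp
    next
      case 3
      have "\<bar>cdf Q x - cdf P x\<bar> \<le> 1"
        using Q.cdf_bounded_prob[of x] P.cdf_bounded_prob[of x] Q.cdf_nonneg[of x] P.cdf_nonneg[of x] by linarith
      then have "ennreal \<bar>cdf Q x - cdf P x\<bar> * indicator {0..} x \<le> 1"
        by (auto simp: indicator_def ennreal_le_1)
      also have "1 = (indicator {a - \<delta>..a + \<delta>} x :: ennreal)" using 3 by (auto simp: indicator_def abs_le_iff)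
      also have "\<dots> \<le> (\<Sum>a\<in>S0. indicator {a - \<delta>..a + \<delta>} x)"
        using 3 S0(1) by (intro member_le_sum) auto
      finally show ?thesis by (rule order_trans) simp
    next
      case 4
      then have "ennreal \<bar>cdf Q x - cdf P x\<bar> * indicator {0..} x \<le> ennreal \<eta> * indicator {0..B} x"
        using diff[of x] by (auto intro: ennreal_leI)
      then show ?thesis by (rule order_trans) simp
    qed simp
  qed
  also have "\<dots> = ennreal \<eta> * ennreal B + (\<Sum>a\<in>S0. ennreal (2 * \<delta>))"
  proof -
    have "(\<integral>\<^sup>+x. (ennreal \<eta> * indicator {0..B} x + (\<Sum>a\<in>S0. indicator {a - \<delta>..a + \<delta>} x)) \<partial>lborel)
       = (\<integral>\<^sup>+x. ennreal \<eta> * indicator {0..B} x \<partial>lborel)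
       + (\<Sum>a\<in>S0. \<integral>\<^sup>+x. indicator {a - \<delta>..a + \<delta>} x \<partial>lborel)"
      by (simp add: nn_integral_add nn_integral_sum)
    also have "(\<integral>\<^sup>+x. ennreal \<eta> * indicator {0..B} x \<partial>lborel) = ennreal \<eta> * ennreal B"
      using S0 by (simp add: nn_integral_cmult_indicator)
    also have "(\<Sum>a\<in>S0. \<integral>\<^sup>+x. indicator {a - \<delta>..a + \<delta>} x \<partial>lborel) = (\<Sum>a\<in>S0. ennreal (2 * \<delta>))"
      using S0 by (intro sum.cong) auto
    finally show ?thesis .
  qed
  also have "\<dots> = ennreal (B * \<eta> + 2 * \<delta> * real (card S0))"
    using S0 by (simp add: ennreal_mult[symmetric] ennreal_of_nat_eq_real_of_nat ennreal_plus[symmetric]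
        mult.commute mult.left_commute del: ennreal_plus)
  finally show ?thesis .
qed

text \<open>s is chosen before Q, K and B: in the application Q and B vary with the sample point,
  while a single s has to serve almost all of them.\<close>

lemma wasserstein_rate_of_poisson_mixtures:
  assumes P: "nonneg_distribution P" "supported_on_at_most m P" "measure P {..c} = 1" and "0 < t"
  shows "\<exists>s>0. \<forall>Q K B. (\<forall>\<^sub>F n in sequentially. nonneg_distribution (Q n) \<and> measure (Q n) {..B} = 1 \<and>
      (\<forall>k. \<bar>(\<Sum>i\<le>k. poisson_mixture (Q n) i) - (\<Sum>i\<le>k. poisson_mixture P i)\<bar> \<le> K * real n powr - t)) \<longrightarrow>
    (\<lambda>n. ennreal (real n powr s) * wasserstein (Q n) P) \<longlonglongrightarrow> 0"
proof -
  interpret P: real_distribution P using nonneg_distributionD[OF P(1)] by simp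
  obtain S0 where S0: "finite S0" "S0 \<subseteq> {0..}" "measure P S0 = 1"
    using positive_atoms[OF P(1,2)] by blast
  obtain C N where C: "0 \<le> C" and CN: "\<And>Q D \<delta> x. nonneg_distribution Q \<Longrightarrow> 0 < \<delta> \<Longrightarrow> \<delta> \<le> 1 \<Longrightarrow>
    (\<forall>k. \<bar>(\<Sum>i\<le>k. poisson_mixture Q i) - (\<Sum>i\<le>k. poisson_mixture P i)\<bar> \<le> D) \<Longrightarrow>
    (\<forall>a\<in>S0. \<delta> < \<bar>x - a\<bar>) \<Longrightarrow> \<bar>cdf Q x - cdf P x\<bar> \<le> C * (\<delta> + (1 / \<delta>) ^ N * D)"
    using cdf_diff_le_off_atoms[OF P(1) S0] by blast
  \<comment> \<open>For this \<tau> and \<delta> = n^(-\<tau>), both \<delta> and (1 / \<delta>)^N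
    n^(-t) equal n^(-\<tau>). Half of the exponent is spent on the scaling factor, the other half
    gives convergence.\<close>
  define \<tau> where "\<tau> = t / real (N + 1)"
  have "0 < \<tau>" using \<open>0 < t\<close> by (simp add: \<tau>_def)
  have \<tau>: "real N * \<tau> - t = - \<tau>"
    by (simp add: \<tau>_def field_simps)
  have "(\<lambda>n. ennreal (real n powr (\<tau> / 2)) * wasserstein (Q n) P) \<longlonglongrightarrow> 0"
    if Q: "\<forall>\<^sub>F n in sequentially. nonneg_distribution (Q n) \<and> measure (Q n) {..B} = 1 \<and>
      (\<forall>k. \<bar>(\<Sum>i\<le>k. poisson_mixture (Q n) i) - (\<Sum>i\<le>k. poisson_mixture P i)\<bar> \<le> K * real n powr - t)"
    for Q K B
  proof -
    define B' where "B' = max 0 (max B c)"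
    have "B \<le> B'" "c \<le> B'" by (auto simp: B'_def)
    define G where "G = B' * (C * (1 + \<bar>K\<bar>)) + 2 * real (card S0)"
    have upper: "\<forall>\<^sub>F n in sequentially. ennreal (real n powr (\<tau> / 2)) * wasserstein (Q n) P
        \<le> ennreal (G * real n powr (- \<tau> / 2))"
      using Q eventually_ge_at_top[of 1]
    proof eventually_elim
      case (elim n)
      define \<delta> where "\<delta> = real n powr - \<tau>"
      have \<delta>: "0 < \<delta>" "\<delta> \<le> 1"
        using elim(2) \<open>0 < \<tau>\<close> by (auto simp: \<delta>_def powr_minus_divide divide_le_eq_1 ge_one_powr_ge_zero)
      interpret Q: real_distribution "Q n" using nonneg_distributionD elim(1) by blast
      have "(1 / \<delta>) ^ N * real n powr - t = \<delta>"
      proof -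
        have "(1 / \<delta>) ^ N = real n powr (real N * \<tau>)"
          using elim(2) by (simp add: \<delta>_def powr_minus_divide powr_power mult.commute)
        then show ?thesis using \<tau> by (simp add: \<delta>_def powr_add[symmetric])
      qed
      then have K: "(1 / \<delta>) ^ N * (K * real n powr - t) \<le> \<bar>K\<bar> * \<delta>"
        using \<delta> by (simp add: mult.left_commute mult_right_mono)
      have "wasserstein (Q n) P \<le> ennreal (B' * (C * (1 + \<bar>K\<bar>) * \<delta>) + 2 * \<delta> * real (card S0))"
      proof (rule wasserstein_le_of_cdf_diff)
        show "\<bar>cdf (Q n) x - cdf P x\<bar> \<le> C * (1 + \<bar>K\<bar>) * \<delta>" if "\<forall>a\<in>S0. \<delta> < \<bar>x - a\<bar>" for x
        proof -
          have "\<bar>cdf (Q n) x - cdf P x\<bar> \<le> C * (\<delta> + (1 / \<delta>) ^ N * (K * real n powr - t))"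
            using elim(1) that \<delta> by (intro CN) auto
          also have "\<dots> \<le> C * (\<delta> + \<bar>K\<bar> * \<delta>)"
            using C K by (intro mult_left_mono) auto
          finally show ?thesis by (simp add: algebra_simps)
        qed
        show "measure (Q n) {..B'} = 1"
          using Q.finite_measure_mono[of "{..B}" "{..B'}"] elim(1) \<open>B \<le> B'\<close> by (intro antisym Q.prob_le_1) auto
        show "measure P {..B'} = 1"
          using P.finite_measure_mono[of "{..c}" "{..B'}"] P(3) \<open>c \<le> B'\<close> by (intro antisym P.prob_le_1) auto
      qed (use S0(1) \<delta> C Q.real_distribution_axioms P.real_distribution_axioms in \<open>auto simp: B'_def\<close>)
      also have "B' * (C * (1 + \<bar>K\<bar>) * \<delta>) + 2 * \<delta> * real (card S0) = G * \<delta>"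
        by (simp add: G_def algebra_simps)
      finally have "ennreal (real n powr (\<tau> / 2)) * wasserstein (Q n) P
          \<le> ennreal (real n powr (\<tau> / 2)) * ennreal (G * \<delta>)"
        by (rule mult_left_mono) simp
      also have "\<dots> = ennreal (G * (real n powr (\<tau> / 2) * \<delta>))"
        by (subst ennreal_mult'[symmetric]) (simp_all add: mult.left_commute)
      also have "real n powr (\<tau> / 2) * \<delta> = real n powr (- \<tau> / 2)"
        by (simp add: \<delta>_def powr_add[symmetric])
      finally show ?case .
    qed
    have "(\<lambda>n. G * real n powr (- \<tau> / 2)) \<longlonglongrightarrow> G * 0"
      by (intro tendsto_intros) (use \<open>0 < \<tau>\<close> in real_asymp)
    then have "(\<lambda>n. ennreal (G * real n powr (- \<tau> / 2))) \<longlonglongrightarrow> ennreal (G * 0)"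
      by (rule tendsto_ennrealI)
    then have lim: "(\<lambda>n. ennreal (G * real n powr (- \<tau> / 2))) \<longlonglongrightarrow> 0" by simp
    show ?thesis
      by (rule tendsto_sandwich[OF _ upper tendsto_const lim]) simp
  qed
  then show ?thesis using \<open>0 < \<tau>\<close> by (intro exI[of _ "\<tau> / 2"]) auto
qed

text \<open>With positive precision, a minimum distance estimate may keep a tiny mass arbitrarily
  far out, so the mixture gap alone does not control its Wasserstein distance to \<open>P\<close>.
  This is why the rate is claimed under a bound B on the supports, uniform in n but possibly
  depending on the sample point; weak convergence does not feel such vanishing mass.\<close>

theorem lemma6:
  fixes A :: "nat \<Rightarrow> 'a set" and p :: "nat \<Rightarrow> 'a pmf" and P :: "real measure"
    and c_lo c_hi :: real
    and M :: "'s measure" and X :: "nat \<Rightarrow> nat \<Rightarrow> 's \<Rightarrow> 'a"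
    and T :: "nat \<Rightarrow> 'a list \<Rightarrow> real measure"
    and Pt :: "nat \<Rightarrow> 's \<Rightarrow> real measure"
    and q :: "nat \<Rightarrow> real" and D :: "real \<Rightarrow> nat \<Rightarrow> real"
  assumes source: "rare_events_source A p P c_lo c_hi"
    and c_lo: "essinf P (\<lambda>z. ereal z) = ereal c_lo"
    and c_hi: "esssup P (\<lambda>z. ereal z) = ereal c_hi"
    and samples: "iid_samples M p X"
    and T: "\<And>n xs. n \<ge> 1 \<Longrightarrow> length xs = n \<Longrightarrow> set xs \<subseteq> A n \<Longrightarrow> nonneg_distribution (T n xs)"
    and Pt: "\<And>n \<omega>. Pt n \<omega> = T n (sample_list X n \<omega>)"
    and q: "\<And>n. q n = ln (real n) / ln (ln (real n))"
    and D: "\<And>s n. D s n = real n powr (s / (2 * q n))"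
  shows
    "(\<forall>s>0.
        (AE \<omega> in M. weak_conv_m (\<lambda>n. Pt n \<omega>) P) \<and>
        (AE \<omega> in M. (\<lambda>n. ennreal (real n powr s) * wasserstein (Pt n \<omega>) P) \<longlonglongrightarrow> 0) \<longrightarrow>
        (AE \<omega> in M.
          (\<lambda>n. (LINT x:{0..}|Pt n \<omega>. tapered (D s n) (\<lambda>x. x powr (- q n)) x) powr (- 1 / q n))
            \<longlonglongrightarrow> c_lo) \<and>
        (AE \<omega> in M.
          (\<lambda>n. (LINT x:{0..}|Pt n \<omega>. tapered (D s n) (\<lambda>x. x powr q n) x) powr (1 / q n))
            \<longlonglongrightarrow> c_hi)) \<and>
     (\<forall>m r \<epsilon>.
        r > 0 \<and> (\<lambda>n. ennreal (real n powr r) * wasserstein (rare_law p n) P) \<longlonglongrightarrow> 0 \<and>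
        supported_on_at_most m P \<and>
        (\<forall>n\<ge>1. \<epsilon> n < real n powr (- min r (1 / 2))) \<and>
        (AE \<omega> in M. \<forall>n\<ge>1.
          min_distance_estimate m (\<epsilon> n) (good_turing (A n) (sample_list X n \<omega>)) (Pt n \<omega>)) \<longrightarrow>
        (AE \<omega> in M. weak_conv_m (\<lambda>n. Pt n \<omega>) P) \<and>
        ((AE \<omega> in M. \<exists>B. \<forall>n\<ge>1. measure (Pt n \<omega>) {..B} = 1) \<longrightarrow>
          (\<exists>s>0. AE \<omega> in M.
            (\<lambda>n. ennreal (real n powr s) * wasserstein (Pt n \<omega>) P) \<longlonglongrightarrow> 0)))"
proof (intro conjI allI impI; (elim conjE)?)
  have src: "0 < c_lo" "c_lo \<le> c_hi" "real_distribution P"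
    "\<And>n. 1 \<le> n \<Longrightarrow> finite (A n)" "\<And>n. 1 \<le> n \<Longrightarrow> set_pmf (p n) \<subseteq> A n"
    using source by (auto simp: rare_events_source_def)
  interpret P: real_distribution P by fact
  have between: "AE z in P. c_lo \<le> z \<and> z \<le> c_hi"
    by (rule P.AE_between_essinf_esssup[OF c_lo c_hi])
  have P_nonneg: "nonneg_distribution P"
    unfolding nonneg_distribution_def
  proof (intro conjI src)
    have "AE z in P. z \<in> {0..}" using between by eventually_elim (use src in auto)
    then show "measure P {0..} = 1" by (subst P.prob_eq_1) auto
  qed
  have fin: "finite (set_pmf (p n))" if "1 \<le> n" for n
    using src(4,5)[OF that] by (rule rev_finite_subset)
  \<comment> \<open>\<open>T\<close> is known to return laws on the half-line for lists over
    \<open>A n\<close>; taking the empty bad set in \<open>AE_eventually_sample_list\<close> shows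
    that the samples eventually stay in the support.\<close>
  have Pt_nonneg: "AE \<omega> in M. \<forall>\<^sub>F n in sequentially. nonneg_distribution (Pt n \<omega>)"
  proof -
    have "AE \<omega> in M. \<forall>\<^sub>F n in sequentially.
        set (sample_list X n \<omega>) \<subseteq> set_pmf (p n) \<and> sample_list X n \<omega> \<notin> {}"
      using samples fin by (intro AE_eventually_sample_list) simp_all
    then show ?thesis
    proof eventually_elim
      case (elim \<omega>)
      then show ?case using eventually_ge_at_top[of 1]
      proof eventually_elim
        case (elim n)
        then show ?case
          unfolding Pt using src(5)[of n] by (intro T) (auto simp: sample_list_def)
      qed
    qed
  qed
  {
    fix s :: real assume "0 < s"
      and W: "AE \<omega> in M. (\<lambda>n. ennreal (real n powr s) * wasserstein (Pt n \<omega>) P) \<longlonglongrightarrow> 0"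
    show "AE \<omega> in M.
      (\<lambda>n. (LINT x:{0..}|Pt n \<omega>. tapered (D s n) (\<lambda>x. x powr (- q n)) x) powr (- 1 / q n)) \<longlonglongrightarrow> c_lo"
      using Pt_nonneg W
    proof eventually_elim
      case (elim \<omega>)
      \<comment> \<open>Case \<sigma> = -1: the root tends to 1 / c_lo, the essential supremum of 1
        / z, and the exponent - 1 / q n of the claim then takes the reciprocal.\<close>
      have "(\<lambda>n. (LINT x:{0..}|Pt n \<omega>. tapered (D s n) (\<lambda>x. x powr (- 1 * q n)) x) powr (1 / q n)) \<longlonglongrightarrow> 1 / c_lo"
        unfolding D q
      proof (rule tapered_root_limit[OF _ \<open>0 < s\<close> src(3,1) between _ _ _ elim])
        show "AE z in P. z powr - 1 \<le> 1 / c_lo"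
          using between by eventually_elim
            (use src in \<open>auto simp: powr_minus_divide intro!: divide_left_mono\<close>)
        show "0 < measure P {z. y < z powr - 1}" if "0 < y" "y < 1 / c_lo" for y
        proof -
          have "c_lo < 1 / y" using that src by (simp add: field_simps)
          then have "0 < measure P {..<1 / y}" by (rule P.prob_below_pos_of_essinf[OF c_lo])
          also have "\<dots> \<le> measure P {z. y < z powr - 1}"
          proof (rule P.finite_measure_mono_AE)
            show "AE z in P. z \<in> {..<1 / y} \<longrightarrow> z \<in> {z. y < z powr - 1}"
              using between by eventually_elim
                (use src that in \<open>auto simp: powr_minus_divide field_simps\<close>)
          qed measurable
          finally show ?thesis .
        qed
      qed (use src in auto)
      then have "(\<lambda>n. inverse ((LINT x:{0..}|Pt n \<omega>. tapered (D s n) (\<lambda>x. x powr (- 1 * q n)) x) powr (1 / q n)))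
          \<longlonglongrightarrow> inverse (1 / c_lo)"
        using src by (intro tendsto_inverse) auto
      then show ?case by (simp add: powr_minus[symmetric])
    qed
    show "AE \<omega> in M.
      (\<lambda>n. (LINT x:{0..}|Pt n \<omega>. tapered (D s n) (\<lambda>x. x powr q n) x) powr (1 / q n)) \<longlonglongrightarrow> c_hi"
      using Pt_nonneg W
    proof eventually_elim
      case (elim \<omega>)
      have "(\<lambda>n. (LINT x:{0..}|Pt n \<omega>. tapered (D s n) (\<lambda>x. x powr (1 * q n)) x) powr (1 / q n)) \<longlonglongrightarrow> c_hi"
        unfolding D q
      proof (rule tapered_root_limit[OF _ \<open>0 < s\<close> src(3,1) between _ _ _ elim])
        show "AE z in P. z powr 1 \<le> c_hi"
          using between by eventually_elim (use src in auto)
        show "0 < measure P {z. y < z powr 1}" if "0 < y" "y < c_hi" for y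
        proof -
          have "0 < measure P {y<..}" by (rule P.prob_above_pos_of_esssup[OF c_hi that(2)])
          also have "\<dots> \<le> measure P {z. y < z powr 1}"
            using that by (intro P.finite_measure_mono) auto
          finally show ?thesis .
        qed
      qed (use src in auto)
      then show ?case by simp
    qed
  }
  fix m :: nat and r :: real and \<epsilon> :: "nat \<Rightarrow> real"
  assume "0 < r"
    and W: "(\<lambda>n. ennreal (real n powr r) * wasserstein (rare_law p n) P) \<longlonglongrightarrow> 0"
    and supp: "supported_on_at_most m P"
    and \<epsilon>: "\<forall>n\<ge>1. \<epsilon> n < real n powr (- min r (1 / 2))"
    and mde: "AE \<omega> in M. \<forall>n\<ge>1.
      min_distance_estimate m (\<epsilon> n) (good_turing (A n) (sample_list X n \<omega>)) (Pt n \<omega>)"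
  define t where "t = min r (1 / 8)"
  \<comment> \<open>Twice the constant of the mixture gap rate, plus 1 for the precision, which is
    at most n^(-t) because t \<le> min r (1 / 2).\<close>
  define K where "K = 2 * (c_hi\<^sup>2 + 2 * c_hi + 2) + 1"
  have "0 < t" using \<open>0 < r\<close> by (simp add: t_def)
  have P_le: "AE z in P. z \<le> c_hi" using between by eventually_elim simp
  have close: "AE \<omega> in M. \<forall>\<^sub>F n in sequentially. nonneg_distribution (Pt n \<omega>) \<and>
      (\<forall>k. \<bar>(\<Sum>i\<le>k. poisson_mixture (Pt n \<omega>) i) - (\<Sum>i\<le>k. poisson_mixture P i)\<bar> \<le> K * real n powr - t)"
    using AE_mixture_gap_rate[OF source samples P_nonneg P_le \<open>0 < r\<close> W] mde
  proof eventually_elim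
    case (elim \<omega>)
    from elim(1) show ?case using eventually_ge_at_top[of 1]
    proof eventually_elim
      case (elim n)
      let ?G = "mixture_gap (good_turing (A n) (sample_list X n \<omega>)) P"
      have mde_n: "min_distance_estimate m (\<epsilon> n) (good_turing (A n) (sample_list X n \<omega>)) (Pt n \<omega>)"
        using \<open>\<forall>n\<ge>1. min_distance_estimate m (\<epsilon> n) (good_turing (A n) (sample_list X n \<omega>)) (Pt n \<omega>)\<close> elim(2)
        by blast
      note est = min_distance_estimate_diff_le[OF src(4)[OF elim(2)] mde_n P_nonneg supp]
      have "\<epsilon> n \<le> real n powr - t"
      proof -
        have "real n powr (- min r (1 / 2)) \<le> real n powr - t"
          using elim(2) by (intro powr_mono) (auto simp: t_def)
        then show ?thesis using \<epsilon> elim(2) by force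
      qed
      moreover have "?G \<le> (c_hi\<^sup>2 + 2 * c_hi + 2) * real n powr - t"
        using elim(1) by (simp add: t_def)
      ultimately have "2 * ?G + \<epsilon> n \<le> K * real n powr - t"
        by (simp add: K_def algebra_simps)
      then show ?case using est order_trans by blast
    qed
  qed
  show "AE \<omega> in M. weak_conv_m (\<lambda>n. Pt n \<omega>) P"
    using close
  proof eventually_elim
    case (elim \<omega>)
    have "(\<lambda>n. K * real n powr - t) \<longlonglongrightarrow> K * 0"
      by (intro tendsto_intros) (use \<open>0 < t\<close> in real_asymp)
    then show ?case by (intro weak_conv_of_poisson_mixtures[OF P_nonneg supp elim]) simp
  qed
  assume bounded: "AE \<omega> in M. \<exists>B. \<forall>n\<ge>1. measure (Pt n \<omega>) {..B} = 1"
  have "measure P {..c_hi} = 1" using P_le by (subst P.prob_eq_1) auto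
  from wasserstein_rate_of_poisson_mixtures[OF P_nonneg supp this \<open>0 < t\<close>]
  obtain s where "0 < s" and s: "\<And>Q K B. (\<forall>\<^sub>F n in sequentially. nonneg_distribution (Q n) \<and> measure (Q n) {..B} = 1 \<and>
      (\<forall>k. \<bar>(\<Sum>i\<le>k. poisson_mixture (Q n) i) - (\<Sum>i\<le>k. poisson_mixture P i)\<bar> \<le> K * real n powr - t)) \<Longrightarrow>
    (\<lambda>n. ennreal (real n powr s) * wasserstein (Q n) P) \<longlonglongrightarrow> 0" by blast
  show "\<exists>s>0. AE \<omega> in M. (\<lambda>n. ennreal (real n powr s) * wasserstein (Pt n \<omega>) P) \<longlonglongrightarrow> 0"
  proof (intro exI[of _ s] conjI \<open>0 < s\<close>)
    show "AE \<omega> in M. (\<lambda>n. ennreal (real n powr s) * wasserstein (Pt n \<omega>) P) \<longlonglongrightarrow> 0"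
      using close bounded
    proof eventually_elim
      case (elim \<omega>)
      obtain B where B: "\<forall>n\<ge>1. measure (Pt n \<omega>) {..B} = 1" using elim(2) by blast
      show ?case
      proof (rule s[of _ B K])
        show "\<forall>\<^sub>F n in sequentially. nonneg_distribution (Pt n \<omega>) \<and> measure (Pt n \<omega>) {..B} = 1 \<and>
          (\<forall>k. \<bar>(\<Sum>i\<le>k. poisson_mixture (Pt n \<omega>) i) - (\<Sum>i\<le>k. poisson_mixture P i)\<bar> \<le> K * real n powr - t)"
          using elim(1) eventually_ge_at_top[of 1] by eventually_elim (use B in auto)
      qed
    qed
  qed
qed

end
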